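(* Let $\mathbf r:U\to\mathbb R^3$ be a pseudospherical surface in Dini's parameterisation with Chebyshev angle $\phi$ and unit normal $\mathbf n$, and let $\Phi$ be a solution of the Moutard equation $\Phi_{xy}=\Phi\cos\phi$ on $U$. The Voss surface $$\mathbf q=\Phi\,\mathbf n-\frac{\Phi_y\mathbf r_x+\Phi_x\mathbf r_y}{\sin\phi}$$ corresponding to $\Phi$ is degenerate if and only if $$\mathcal R\Phi+\Phi\in\mathcal R0 .$$
   Context: All functions are smooth; $U\subset\mathbb R^2$ is a connected, simply connected open set with coordinates $x,y$. A pseudospherical surface in Dini's parameterisation with Chebyshev angle $\phi$ is a map $\mathbf r:U\to\mathbb R^3$ with unit normal $\mathbf n$ whose fundamental forms are $\mathrm I=dx^2+2\cos\phi\,dx\,dy+dy^2$, $\mathrm{II}=2\sin\phi\,dx\,dy$, where $\sin\phi\neq0$ on $U$. Equivalently, $\phi_{xy}=\sin\phi$ (sine-Gordon equation) and $$\mathbf r_{xx}=\tfrac{\phi_x}{\tan\phi}\mathbf r_x-\tfrac{\phi_x}{\sin\phi}\mathbf r_y,\quad \mathbf r_{xy}=\sin\phi\,\mathbf n,\quad \mathbf r_{yy}=-\tfrac{\phi_y}{\sin\phi}\mathbf r_x+\tfrac{\phi_y}{\tan\phi}\mathbf r_y,$$ $$\mathbf n_x=\tfrac1{\tan\phi}\mathbf r_x-\tfrac1{\sin\phi}\mathbf r_y,\quad \mathbf n_y=\tfrac1{\tan\phi}\mathbf r_y-\tfrac1{\sin\phi}\mathbf r_x .$$ Degenerate means that the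 net $\mathbf q$ degenerates to a point (is constant on $U$); equivalently, both functions $X=\Phi_{xx}+\Phi-\big(\frac{\Phi_x}{\tan\phi}+\frac{\Phi_y}{\sin\phi}\big)\phi_x$ and $Y=\Phi_{yy}+\Phi-\big(\frac{\Phi_y}{\tan\phi}+\frac{\Phi_x}{\sin\phi}\big)\phi_y$ vanish identically (one has $\mathbf q_x=-\frac{X}{\sin\phi}\mathbf r_y$, $\mathbf q_y=-\frac{Y}{\sin\phi}\mathbf r_x$). $\mathcal R$ is the multivalued recursion operator: $\mathcal R\Phi=\Phi_{xx}+\phi_xQ$, where $Q$ is any function satisfying $Q_x=\Phi_x\phi_x$, $Q_y=\Phi\sin\phi$ (unique up to an additive constant). $\mathcal R0$ denotes the set of all values on the zero solution, $\mathcal R0=\phi_x\mathbb R=\{c\,\phi_x: c\in\mathbb R\}$; $\mathcal R\Phi$ is defined modulo $\mathcal R0$, so the condition does not depend on the choice of $Q$. *)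

theory Defs
  imports "HOL-Analysis.Analysis"
begin

text \<open>Functions of the coordinates \<open>(x, y)\<close> are total functions on \<open>real \<times> real\<close>; only their values
  on the domain \<open>U\<close>, which is open wherever these notions are used, are relevant.\<close>

definition dx :: "(real \<times> real \<Rightarrow> 'a::real_normed_vector) \<Rightarrow> real \<times> real \<Rightarrow> 'a" where
  "dx f p = vector_derivative (\<lambda>t. f (t, snd p)) (at (fst p))"

definition dy :: "(real \<times> real \<Rightarrow> 'a::real_normed_vector) \<Rightarrow> real \<times> real \<Rightarrow> 'a" where
  "dy f p = vector_derivative (\<lambda>t. f (fst p, t)) (at (snd p))"

primrec Ck_on :: "nat \<Rightarrow> (real \<times> real) set \<Rightarrow> (real \<times> real \<Rightarrow> 'a::real_normed_vector) \<Rightarrow> bool" where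
  "Ck_on 0 U f \<longleftrightarrow> continuous_on U f"
| "Ck_on (Suc k) U f \<longleftrightarrow> f differentiable_on U \<and> Ck_on k U (dx f) \<and> Ck_on k U (dy f)"

definition smooth_on :: "(real \<times> real) set \<Rightarrow> (real \<times> real \<Rightarrow> 'a::real_normed_vector) \<Rightarrow> bool" where
  "smooth_on U f \<longleftrightarrow> (\<forall>k. Ck_on k U f)"

text \<open>The first fundamental form is \<open>\<langle>dr, dr\<rangle>\<close> and the second one is
  \<open>\<langle>d\<^sup>2r, n\<rangle> = - \<langle>dr, dn\<rangle>\<close>. As \<open>sin \<phi> \<noteq> 0\<close>, the second form also fixes the sign of the unit normal.\<close>

definition pseudospherical_dini ::
    "(real \<times> real) set \<Rightarrow> (real \<times> real \<Rightarrow> real) \<Rightarrow> (real \<times> real \<Rightarrow> real^3) \<Rightarrow> (real \<times> real \<Rightarrow> real^3) \<Rightarrow> bool"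
  where
  "pseudospherical_dini U \<phi> r n \<longleftrightarrow>
     smooth_on U \<phi> \<and> smooth_on U r \<and> smooth_on U n \<and>
     (\<forall>p\<in>U. sin (\<phi> p) \<noteq> 0 \<and>
        norm (n p) = 1 \<and> n p \<bullet> dx r p = 0 \<and> n p \<bullet> dy r p = 0 \<and>
        dx r p \<bullet> dx r p = 1 \<and> dx r p \<bullet> dy r p = cos (\<phi> p) \<and> dy r p \<bullet> dy r p = 1 \<and>
        dx (dx r) p \<bullet> n p = 0 \<and> dy (dx r) p \<bullet> n p = sin (\<phi> p) \<and> dy (dy r) p \<bullet> n p = 0)"

definition moutard_solution ::
    "(real \<times> real) set \<Rightarrow> (real \<times> real \<Rightarrow> real) \<Rightarrow> (real \<times> real \<Rightarrow> real) \<Rightarrow> bool" where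
  "moutard_solution U \<phi> \<Phi> \<longleftrightarrow>
     smooth_on U \<Phi> \<and> (\<forall>p\<in>U. dy (dx \<Phi>) p = \<Phi> p * cos (\<phi> p))"

definition voss ::
    "(real \<times> real \<Rightarrow> real) \<Rightarrow> (real \<times> real \<Rightarrow> real^3) \<Rightarrow> (real \<times> real \<Rightarrow> real^3) \<Rightarrow>
     (real \<times> real \<Rightarrow> real) \<Rightarrow> real \<times> real \<Rightarrow> real^3" where
  "voss \<phi> r n \<Phi> p =
     \<Phi> p *\<^sub>R n p - (1 / sin (\<phi> p)) *\<^sub>R (dy \<Phi> p *\<^sub>R dx r p + dx \<Phi> p *\<^sub>R dy r p)"

definition degenerate_net :: "(real \<times> real) set \<Rightarrow> (real \<times> real \<Rightarrow> real^3) \<Rightarrow> bool" where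
  "degenerate_net U q \<longleftrightarrow> q constant_on U"

text \<open>The set of all values on \<open>\<Phi>\<close> of the multivalued recursion operator, one for each admissible
  \<open>Q\<close>. A value is a function on \<open>U\<close>, so its extension beyond \<open>U\<close> is left arbitrary.\<close>

definition recursion_op ::
    "(real \<times> real) set \<Rightarrow> (real \<times> real \<Rightarrow> real) \<Rightarrow> (real \<times> real \<Rightarrow> real) \<Rightarrow> (real \<times> real \<Rightarrow> real) set"
  where
  "recursion_op U \<phi> \<Phi> =
     {\<Psi>. \<exists>Q. smooth_on U Q \<and>
          (\<forall>p\<in>U. dx Q p = dx \<Phi> p * dx \<phi> p \<and> dy Q p = \<Phi> p * sin (\<phi> p)) \<and>
          (\<forall>p\<in>U. \<Psi> p = dx (dx \<Phi>) p + dx \<phi> p * Q p)}"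

end

theory Submission
  imports Defs "HOL-Complex_Analysis.Riemann_Mapping"
begin

text \<open>The partial derivatives of the net are \<open>q\<^sub>x = - (X / sin \<phi>) r\<^sub>y\<close> and
  \<open>q\<^sub>y = - (Y / sin \<phi>) r\<^sub>x\<close>, so \<open>q\<close> is constant iff \<open>X = Y = 0\<close>. The function
  \<open>Q\<^sub>0 = - (\<Phi>\<^sub>x cot \<phi> + \<Phi>\<^sub>y / sin \<phi>)\<close> satisfies \<open>X = \<Phi>\<^sub>x\<^sub>x + \<Phi> + \<phi>\<^sub>x Q\<^sub>0\<close>, and its partial derivatives are
  \<open>\<Phi>\<^sub>x \<phi>\<^sub>x - X cot \<phi>\<close> and \<open>\<Phi> sin \<phi> - Y / sin \<phi>\<close>. If \<open>X = Y = 0\<close>, it is therefore an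
  admissible \<open>Q\<close>, for which the recursion operator gives \<open>- \<Phi>\<close>. Conversely, if
  \<open>\<Phi>\<^sub>x\<^sub>x + \<Phi> + \<phi>\<^sub>x (Q - c) = 0\<close>, differentiation in \<open>y\<close> and division by \<open>\<phi>\<^sub>x\<^sub>y = sin \<phi>\<close> give \<open>Q - c = Q\<^sub>0\<close>,
  whence \<open>X = Y = 0\<close>.

  A function \<open>Q\<close> exists because the form defining it is closed. The Poincare lemma on a simply
  connected plane domain is reduced to the disc by pulling the form back along a Riemann map.\<close>

subsection \<open>Potentials of curl-free fields\<close>

text \<open>The potential is the integral of \<open>V (t x) \<bullet> x\<close> over
  \<open>t\<close> in [0, 1]. Its derivative in direction \<open>h\<close> has the integrand
  \<open>w x t h\<close>. By the symmetry of \<open>V'\<close> this is the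
  \<open>t\<close>-derivative of \<open>t * (V (t x) \<bullet> h)\<close>, whose increment over
  [0, 1] is \<open>V x \<bullet> h\<close>.\<close>

lemma curl_free_convex_potential:
  fixes V :: "'a::euclidean_space \<Rightarrow> 'a"
  assumes "open S" "convex S" "0 \<in> S"
    and V: "\<And>x. x \<in> S \<Longrightarrow> (V has_derivative V' x) (at x)"
    and sym: "\<And>x a b. x \<in> S \<Longrightarrow> V' x a \<bullet> b = V' x b \<bullet> a"
    and cont: "\<And>a. continuous_on S (\<lambda>x. V' x a)"
  shows "\<exists>F. \<forall>x\<in>S. (F has_derivative (\<lambda>h. V x \<bullet> h)) (at x)"
proof -
  define w where "w x t h = t * (V' (t *\<^sub>R x) h \<bullet> x) + V (t *\<^sub>R x) \<bullet> h" for x :: 'a and t :: real and h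
  have seg: "t *\<^sub>R x \<in> S" if "x \<in> S" "t \<in> {0..1}" for x and t :: real
    using convexD_alt[OF \<open>convex S\<close> \<open>0 \<in> S\<close> that(1), of t] that(2) by simp
  have lin: "bounded_linear (V' x)" if "x \<in> S" for x
    using V[OF that] by (rule has_derivative_bounded_linear)
  have blin: "bounded_linear (w x t)" if "x \<in> S" "t \<in> {0..1}" for x t
    unfolding w_def
    by (intro bounded_linear_add bounded_linear_const_mult bounded_linear_inner_left_comp
        bounded_linear_inner_right lin seg that)
  have contV: "continuous_on S V"
    by (meson V continuous_at_imp_continuous_on has_derivative_continuous)
  have cont_scale: "continuous_on (S \<times> cbox 0 1) (\<lambda>z. g (snd z *\<^sub>R fst z))"
    if "continuous_on S g" for g :: "'a \<Rightarrow> 'a"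
    by (rule continuous_on_compose2[OF that]) (auto intro!: continuous_intros seg)
  define F where "F x = integral (cbox 0 1) (\<lambda>t::real. V (t *\<^sub>R x) \<bullet> x)" for x
  have "(F has_derivative (\<lambda>h. V x \<bullet> h)) (at x)" if x: "x \<in> S" for x
  proof -
    \<comment> \<open>The Leibniz rule integrates the derivative as a map into the normed space of
      bounded linear functions, hence the wrapping of \<open>w x t\<close> by
      \<open>Blinfun\<close>.\<close>
    have "((\<lambda>x. integral (cbox 0 1) (\<lambda>t::real. V (t *\<^sub>R x) \<bullet> x)) has_derivative
            integral (cbox 0 1) (\<lambda>t. Blinfun (w x t))) (at x within S)"
    proof (rule leibniz_rule[where fx = "\<lambda>x t. Blinfun (w x t)"])
      fix y and t :: real
      assume y: "y \<in> S" and t: "t \<in> cbox 0 1"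
      have "((\<lambda>x. t *\<^sub>R x) has_derivative (\<lambda>h. t *\<^sub>R h)) (at y within S)"
        by (auto intro!: derivative_eq_intros)
      moreover have "(V has_derivative V' (t *\<^sub>R y)) (at (t *\<^sub>R y))"
        using V seg y t by simp
      ultimately have "((\<lambda>x. V (t *\<^sub>R x)) has_derivative (\<lambda>h. V' (t *\<^sub>R y) (t *\<^sub>R h))) (at y within S)"
        by (rule has_derivative_compose)
      hence "((\<lambda>x. V (t *\<^sub>R x) \<bullet> x) has_derivative w y t) (at y within S)"
        unfolding w_def
        using linear_cmul[OF bounded_linear.linear[OF lin[OF seg]]] y t
        by (auto intro!: derivative_eq_intros)
      thus "((\<lambda>x. V (t *\<^sub>R x) \<bullet> x) has_derivative blinfun_apply (Blinfun (w y t))) (at y within S)"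
        using blin y t by (simp add: bounded_linear_Blinfun_apply)
    next
      fix y assume "y \<in> S"
      then show "(\<lambda>t::real. V (t *\<^sub>R y) \<bullet> y) integrable_on cbox 0 1"
        by (intro integrable_continuous continuous_intros continuous_on_compose2[OF contV])
           (auto intro: seg)
    next
      \<comment> \<open>In finite dimension, continuity in the operator norm reduces to continuity
        on each basis vector, so continuity of \<open>V' x a\<close> for fixed \<open>a\<close>
        suffices.\<close>
      show "continuous_on (S \<times> cbox 0 1) (\<lambda>(x, t). Blinfun (w x t))"
      proof (rule continuous_on_blinfun_componentwise)
        fix i :: 'a
        have "continuous_on (S \<times> cbox 0 1) (\<lambda>z. w (fst z) (snd z) i)"
          unfolding w_def using cont_scale[OF cont] cont_scale[OF contV]
          by (intro continuous_intros) auto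
        then show "continuous_on (S \<times> cbox 0 1) (\<lambda>z. blinfun_apply (case z of (x, t) \<Rightarrow> Blinfun (w x t)) i)"
          by (rule continuous_on_eq) (use blin in \<open>auto simp: bounded_linear_Blinfun_apply\<close>)
      qed
    qed (use assms x in auto)
    then have F: "(F has_derivative integral (cbox 0 1) (\<lambda>t. Blinfun (w x t))) (at x)"
      unfolding F_def using at_within_open[OF x \<open>open S\<close>] by simp
    have "blinfun_apply (integral (cbox 0 1) (\<lambda>t. Blinfun (w x t))) h = V x \<bullet> h" for h
    proof -
      have cw: "continuous_on (cbox 0 1) (\<lambda>t. Blinfun (w x t))"
      proof (rule continuous_on_blinfun_componentwise)
        fix i :: 'a
        have c: "continuous_on (cbox 0 1) (\<lambda>t::real. g (t *\<^sub>R x))" if "continuous_on S g" for g :: "'a \<Rightarrow> 'a"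
          by (rule continuous_on_compose2[OF that]) (auto intro!: continuous_intros seg x)
        have "continuous_on (cbox 0 1) (\<lambda>t. w x t i)"
          unfolding w_def using c[OF cont] c[OF contV]
          by (intro continuous_intros) auto
        then show "continuous_on (cbox 0 1) (\<lambda>t. blinfun_apply (Blinfun (w x t)) i)"
          by (rule continuous_on_eq) (use blin x in \<open>auto simp: bounded_linear_Blinfun_apply\<close>)
      qed
      \<comment> \<open>Evaluation at \<open>h\<close> is a bounded linear functional and so
        commutes with the integral.\<close>
      have "blinfun_apply (integral (cbox 0 1) (\<lambda>t. Blinfun (w x t))) h
          = integral (cbox 0 1) (\<lambda>t. blinfun_apply (Blinfun (w x t)) h)"
        using integral_linear[OF integrable_continuous[OF cw] bounded_linear_apply_blinfun[of h]]
        by (simp add: o_def)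
      also have "\<dots> = integral {0..1} (\<lambda>t. t * (V' (t *\<^sub>R x) h \<bullet> x) + V (t *\<^sub>R x) \<bullet> h)"
        using blin x by (auto intro!: integral_cong simp: bounded_linear_Blinfun_apply w_def)
      also have "\<dots> = 1 * (V (1 *\<^sub>R x) \<bullet> h) - 0 * (V (0 *\<^sub>R x) \<bullet> h)"
      proof (rule integral_unique, rule fundamental_theorem_of_calculus)
        fix t :: real assume t: "t \<in> {0..1}"
        have "((\<lambda>t. t *\<^sub>R x) has_derivative (\<lambda>s. s *\<^sub>R x)) (at t within {0..1})"
          by (auto intro!: derivative_eq_intros)
        moreover have "(V has_derivative V' (t *\<^sub>R x)) (at (t *\<^sub>R x))"
          using V seg x t by simp
        ultimately have "((\<lambda>t. V (t *\<^sub>R x)) has_derivative (\<lambda>s. V' (t *\<^sub>R x) (s *\<^sub>R x))) (at t within {0..1})"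
          by (rule has_derivative_compose)
        hence "((\<lambda>t. V (t *\<^sub>R x)) has_vector_derivative V' (t *\<^sub>R x) x) (at t within {0..1})"
          using linear_cmul[OF bounded_linear.linear[OF lin[OF seg[OF x t]]]]
          by (simp add: has_vector_derivative_def)
        then have "((\<lambda>t. V (t *\<^sub>R x) \<bullet> h) has_vector_derivative V' (t *\<^sub>R x) x \<bullet> h) (at t within {0..1})"
          by (rule bounded_linear.has_vector_derivative[OF bounded_linear_inner_left])
        then show "((\<lambda>t. t * (V (t *\<^sub>R x) \<bullet> h)) has_vector_derivative
              t * (V' (t *\<^sub>R x) h \<bullet> x) + V (t *\<^sub>R x) \<bullet> h) (at t within {0..1})"
          by (auto simp: sym[OF seg[OF x t], of h x] intro!: derivative_eq_intros)
      qed simp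
      finally show ?thesis by simp
    qed
    with F show ?thesis
      by (metis (no_types, lifting) ext has_derivative_eq_rhs)
  qed
  then show ?thesis by blast
qed

text \<open>By the Riemann mapping theorem \<open>S\<close> is empty, the whole plane, or
  biholomorphic to the disc. In the last case the pullback of a closed form is closed, so it has a
  potential \<open>F\<close> on the disc, and \<open>F\<close> composed with the inverse map
  \<open>k\<close> is a potential on \<open>S\<close>.\<close>

lemma curl_free_simply_connected_potential_complex:
  fixes V :: "complex \<Rightarrow> complex"
  assumes S: "open S" "simply_connected S"
    and V: "\<And>x. x \<in> S \<Longrightarrow> (V has_derivative V' x) (at x)"
    and sym: "\<And>x a b. x \<in> S \<Longrightarrow> V' x a \<bullet> b = V' x b \<bullet> a"
    and cont: "\<And>a. continuous_on S (\<lambda>x. V' x a)"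
  shows "\<exists>F. \<forall>x\<in>S. (F has_derivative (\<lambda>h. V x \<bullet> h)) (at x)"
proof -
  consider "S = {}" | "S = UNIV" | k f where "k holomorphic_on S" "f holomorphic_on ball 0 1"
      "\<And>z. z \<in> S \<Longrightarrow> k z \<in> ball 0 1 \<and> f (k z) = z" "\<And>z. z \<in> ball 0 1 \<Longrightarrow> f z \<in> S \<and> k (f z) = z"
    using simply_connected_eq_biholomorphic_to_disc[OF S(1)] S(2) by metis
  then show ?thesis
  proof cases
    case 1
    then show ?thesis by simp
  next
    case 2
    then show ?thesis using curl_free_convex_potential[of S V V'] assms by auto
  next
    case (3 k f)
    let ?B = "ball (0::complex) 1"
    have f1: "(f has_field_derivative deriv f z) (at z)" if "z \<in> ?B" for z
      using that holomorphic_derivI[OF 3(2)] by auto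
    have hol': "deriv f holomorphic_on ?B"
      using 3(2) by (intro holomorphic_deriv) auto
    have f2: "(deriv f has_field_derivative deriv (deriv f) z) (at z)" if "z \<in> ?B" for z
      using that holomorphic_derivI[OF hol'] by auto
    have lin: "linear (V' x)" if "x \<in> S" for x
      using V[OF that] by (rule has_derivative_linear)
    \<comment> \<open>With the real inner product on the complex plane, \<open>W\<close> is the pullback of the form \<open>V \<bullet> dz\<close> along \<open>f\<close>.\<close>
    define W where "W z = cnj (deriv f z) * V (f z)" for z
    define W' where "W' z a = cnj (deriv f z) * V' (f z) (deriv f z * a) + cnj (deriv (deriv f) z * a) * V (f z)" for z a
    \<comment> \<open>Multiplication by \<open>cnj c\<close> is the adjoint of multiplication by
      \<open>c\<close>; this is why \<open>W\<close> carries a conjugate.\<close>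
    have inner_mult: "(cnj c * x) \<bullet> y = x \<bullet> (c * y)" for c x y :: complex
      by (simp add: inner_complex_def algebra_simps)
    have Wd: "(W has_derivative W' z) (at z)" if z: "z \<in> ?B" for z
    proof -
      have d1: "((\<lambda>z. V (f z)) has_derivative (\<lambda>a. V' (f z) (deriv f z * a))) (at z)"
        using has_derivative_compose[OF has_field_derivative_imp_has_derivative[OF f1[OF z]] V] 3(4)[OF z]
        by blast
      have d2: "((\<lambda>z. cnj (deriv f z)) has_derivative (\<lambda>a. cnj (deriv (deriv f) z * a))) (at z)"
        using has_field_derivative_imp_has_derivative[OF f2[OF z]] by (rule has_derivative_cnj)
      show ?thesis
        using has_derivative_mult[OF d2 d1] unfolding W_def W'_def .
    qed
    \<comment> \<open>The first term of \<open>W'\<close> inherits its symmetry from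
      \<open>V'\<close>. Paired with \<open>b\<close>, the second becomes the inner product of
      \<open>V (f z)\<close> with \<open>deriv (deriv f) z * a * b\<close>, which is symmetric
      because complex multiplication commutes.\<close>
    have Ws: "W' z a \<bullet> b = W' z b \<bullet> a" if z: "z \<in> ?B" for z a b
      unfolding W'_def inner_add_left inner_mult
      using sym[of "f z" "deriv f z * a" "deriv f z * b"] 3(4)[OF z] by (simp add: mult_ac)
    have Wc: "continuous_on ?B (\<lambda>z. W' z a)" for a
    proof -
      have c: "continuous_on ?B f" "continuous_on ?B (deriv f)" "continuous_on ?B (deriv (deriv f))"
        using 3(2) hol' by (auto intro!: holomorphic_on_imp_continuous_on holomorphic_deriv)
      \<comment> \<open>The argument \<open>deriv f z * a\<close> varies with \<open>z\<close>,
        whereas \<open>cont\<close> speaks of a fixed argument. Expansion in the real basis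
        \<open>1\<close>, \<open>\<i>\<close> leaves only fixed arguments.\<close>
      have V'_decomp: "V' (f z) (deriv f z * a) = Re (deriv f z * a) *\<^sub>R V' (f z) 1 + Im (deriv f z * a) *\<^sub>R V' (f z) \<i>"
        if "z \<in> ?B" for z
      proof -
        have L: "linear (V' (f z))"
          using lin 3(4)[OF that] by blast
        have "deriv f z * a = Re (deriv f z * a) *\<^sub>R 1 + Im (deriv f z * a) *\<^sub>R \<i>"
          by (simp add: complex_eq_iff)
        then show ?thesis
          using linear_add[OF L] linear_cmul[OF L] by metis
      qed
      have cV: "continuous_on S V"
        by (meson V continuous_at_imp_continuous_on has_derivative_continuous)
      have "continuous_on ?B (\<lambda>z. V (f z))" "continuous_on ?B (\<lambda>z. V' (f z) b)" for b
        using 3(4) by (auto intro!: continuous_on_compose2[OF cV] continuous_on_compose2[OF cont] c)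
      with c have "continuous_on ?B (\<lambda>z. cnj (deriv f z) * (Re (deriv f z * a) *\<^sub>R V' (f z) 1
          + Im (deriv f z * a) *\<^sub>R V' (f z) \<i>) + cnj (deriv (deriv f) z * a) * V (f z))"
        by (intro continuous_intros) auto
      then show ?thesis
        by (rule continuous_on_eq) (simp only: W'_def V'_decomp)
    qed
    have "\<exists>F. \<forall>z\<in>?B. (F has_derivative (\<lambda>h. W z \<bullet> h)) (at z)"
      by (rule curl_free_convex_potential[OF open_ball convex_ball _ Wd Ws Wc]) auto
    then obtain F where F: "\<And>z. z \<in> ?B \<Longrightarrow> (F has_derivative (\<lambda>h. W z \<bullet> h)) (at z)"
      by blast
    have "((\<lambda>x. F (k x)) has_derivative (\<lambda>h. V x \<bullet> h)) (at x)" if x: "x \<in> S" for x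
    proof -
      have k: "(k has_field_derivative deriv k x) (at x)"
        using holomorphic_derivI[OF 3(1) S(1) x] .
      have kx: "k x \<in> ?B" "f (k x) = x" using 3(3)[OF x] by auto
      have "((\<lambda>x. f (k x)) has_field_derivative deriv f (k x) * deriv k x) (at x)"
        using DERIV_chain2[OF f1[OF kx(1)] k] .
      \<comment> \<open>On \<open>S\<close> the composite of \<open>k\<close> and \<open>f\<close>
        is the identity, so their derivatives are reciprocal and the factor in the pullback
        cancels.\<close>
      moreover have "((\<lambda>x. f (k x)) has_field_derivative 1) (at x)"
        using DERIV_ident by (rule has_field_derivative_transform_within_open[OF _ S(1) x]) (use 3(3) in auto)
      ultimately have one: "deriv f (k x) * deriv k x = 1"
        by (rule DERIV_unique)
      have "((\<lambda>x. F (k x)) has_derivative (\<lambda>h. W (k x) \<bullet> (deriv k x * h))) (at x)"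
        using has_derivative_compose[OF has_field_derivative_imp_has_derivative[OF k] F[OF kx(1)]] .
      moreover have "W (k x) \<bullet> (deriv k x * h) = V x \<bullet> h" for h
        unfolding W_def inner_mult kx(2) mult.assoc[symmetric] one by simp
      ultimately show ?thesis by simp
    qed
    then show ?thesis by blast
  qed
qed

subsection \<open>Partial derivatives and smooth functions\<close>

lemma has_dx:
  assumes "f differentiable (at p)"
  shows "((\<lambda>t. f (t, snd p)) has_vector_derivative dx f p) (at (fst p))"
proof -
  obtain f' where f': "(f has_derivative f') (at p)"
    using assms by (auto simp: differentiable_def)
  have "((\<lambda>t. (t, snd p)) has_derivative (\<lambda>h. (h, 0))) (at (fst p))"
    by (auto intro!: derivative_eq_intros)
  moreover have "(f has_derivative f') (at (fst p, snd p))"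
    using f' by simp
  ultimately have "((\<lambda>t. f (t, snd p)) has_derivative (\<lambda>h. f' (h, 0))) (at (fst p))"
    by (rule has_derivative_compose)
  then show ?thesis
    unfolding dx_def using differentiableI vector_derivative_works by blast
qed

lemma has_dy:
  assumes "f differentiable (at p)"
  shows "((\<lambda>t. f (fst p, t)) has_vector_derivative dy f p) (at (snd p))"
proof -
  obtain f' where f': "(f has_derivative f') (at p)"
    using assms by (auto simp: differentiable_def)
  have "((\<lambda>t. (fst p, t)) has_derivative (\<lambda>h. (0, h))) (at (snd p))"
    by (auto intro!: derivative_eq_intros)
  moreover have "(f has_derivative f') (at (fst p, snd p))"
    using f' by simp
  ultimately have "((\<lambda>t. f (fst p, t)) has_derivative (\<lambda>h. f' (0, h))) (at (snd p))"
    by (rule has_derivative_compose)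
  then show ?thesis
    unfolding dy_def using differentiableI vector_derivative_works by blast
qed

lemma dx_eqI: "((\<lambda>t. f (t, snd p)) has_vector_derivative D) (at (fst p)) \<Longrightarrow> dx f p = D"
  unfolding dx_def by (rule vector_derivative_at)

lemma dy_eqI: "((\<lambda>t. f (fst p, t)) has_vector_derivative D) (at (snd p)) \<Longrightarrow> dy f p = D"
  unfolding dy_def by (rule vector_derivative_at)

lemma dx_dy_of_has_derivative:
  assumes "(f has_derivative f') (at p)"
  shows "dx f p = f' (1, 0)" "dy f p = f' (0, 1)"
proof -
  have lin: "linear f'" using assms by (rule has_derivative_linear)
  have "((\<lambda>t. (t, snd p)) has_derivative (\<lambda>h. h *\<^sub>R (1, 0))) (at (fst p))"
    "((\<lambda>t. (fst p, t)) has_derivative (\<lambda>h. h *\<^sub>R (0, 1))) (at (snd p))"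
    by (auto intro!: derivative_eq_intros)
  moreover have "(f has_derivative f') (at (fst p, snd p))"
    using assms by simp
  ultimately have "((\<lambda>t. f (t, snd p)) has_derivative (\<lambda>h. f' (h *\<^sub>R (1, 0)))) (at (fst p))"
    "((\<lambda>t. f (fst p, t)) has_derivative (\<lambda>h. f' (h *\<^sub>R (0, 1)))) (at (snd p))"
    by (metis has_derivative_compose)+
  then show "dx f p = f' (1, 0)" "dy f p = f' (0, 1)"
    unfolding linear_cmul[OF lin]
    by (auto intro!: dx_eqI dy_eqI simp: has_vector_derivative_def)
qed

lemma has_derivative_dx_dy:
  assumes "f differentiable (at p)"
  shows "(f has_derivative (\<lambda>h. fst h *\<^sub>R dx f p + snd h *\<^sub>R dy f p)) (at p)"
proof -
  obtain f' where f': "(f has_derivative f') (at p)"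
    using assms by (auto simp: differentiable_def)
  have lin: "linear f'" using f' by (rule has_derivative_linear)
  have "f' h = fst h *\<^sub>R dx f p + snd h *\<^sub>R dy f p" for h
  proof -
    have "h = fst h *\<^sub>R (1, 0) + snd h *\<^sub>R (0, 1)" by (simp add: prod_eq_iff)
    then have "f' h = f' (fst h *\<^sub>R (1, 0) + snd h *\<^sub>R (0, 1))" by simp
    also have "\<dots> = fst h *\<^sub>R f' (1, 0) + snd h *\<^sub>R f' (0, 1)"
      by (simp only: linear_add[OF lin] linear_cmul[OF lin])
    finally show ?thesis by (simp only: dx_dy_of_has_derivative[OF f'])
  qed
  with f' show ?thesis by (metis (no_types, lifting) ext)
qed

text \<open>Partial derivatives look only along coordinate lines. Near a point of \<open>U\<close>
  these lines stay in \<open>U\<close>, which is what allows identities known only on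
  \<open>U\<close> to be differentiated.\<close>

lemma eventually_section_in_open:
  assumes "open U" "p \<in> U"
  shows "eventually (\<lambda>t. (t, snd p) \<in> U) (nhds (fst p))"
    and "eventually (\<lambda>t. (fst p, t) \<in> U) (nhds (snd p))"
proof -
  have "eventually (\<lambda>q. q \<in> U) (nhds p)"
    using assms by (rule eventually_nhds_in_open)
  moreover have "filterlim (\<lambda>t. (t, snd p)) (nhds p) (nhds (fst p))"
    "filterlim (\<lambda>t. (fst p, t)) (nhds p) (nhds (snd p))"
    using tendsto_Pair[OF filterlim_ident tendsto_const] tendsto_Pair[OF tendsto_const filterlim_ident]
    by (metis prod.collapse)+
  ultimately show "eventually (\<lambda>t. (t, snd p) \<in> U) (nhds (fst p))"
    "eventually (\<lambda>t. (fst p, t) \<in> U) (nhds (snd p))"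
    by (auto dest: eventually_compose_filterlim)
qed

lemma dx_cong:
  assumes "open U" "p \<in> U" "\<And>q. q \<in> U \<Longrightarrow> f q = g q"
  shows "dx f p = dx g p"
  unfolding dx_def
  by (rule vector_derivative_cong_eq)
     (use assms eventually_section_in_open(1)[OF assms(1,2)] in \<open>auto elim: eventually_mono\<close>)

lemma dy_cong:
  assumes "open U" "p \<in> U" "\<And>q. q \<in> U \<Longrightarrow> f q = g q"
  shows "dy f p = dy g p"
  unfolding dy_def
  by (rule vector_derivative_cong_eq)
     (use assms eventually_section_in_open(2)[OF assms(1,2)] in \<open>auto elim: eventually_mono\<close>)

section \<open>Closure properties of the classes of k times differentiable functions\<close>

lemma differentiable_on_openD: "f differentiable_on U \<Longrightarrow> open U \<Longrightarrow> p \<in> U \<Longrightarrow> f differentiable (at p)"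
  by (simp add: differentiable_on_eq_differentiable_at)

text \<open>If \<open>f\<close> and \<open>g\<close> agree on the open set \<open>U\<close>, so do
  their partial derivatives, and the induction passes to those. This carries regularity across the
  product and chain rules, which hold on \<open>U\<close> only.\<close>

lemma Ck_on_cong:
  assumes "open U" "\<And>p. p \<in> U \<Longrightarrow> f p = g p" "Ck_on k U f"
  shows "Ck_on k U g"
  using assms(2,3)
proof (induction k arbitrary: f g)
  case 0
  then show ?case using continuous_on_cong[of U U f g] by auto
next
  case (Suc k)
  have "g differentiable_on U"
    unfolding differentiable_on_eq_differentiable_at[OF \<open>open U\<close>]
  proof
    fix p assume p: "p \<in> U"
    then obtain f' where "(f has_derivative f') (at p)"
      using differentiable_on_openD[OF _ \<open>open U\<close> p, of f] Suc.prems(2)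
      unfolding differentiable_def by auto
    then have "(g has_derivative f') (at p)"
      by (rule has_derivative_transform_within_open[OF _ \<open>open U\<close> p]) (use Suc.prems in auto)
    then show "g differentiable (at p)" by (auto simp: differentiable_def)
  qed
  moreover have "Ck_on k U (dx g)" "Ck_on k U (dy g)"
    using Suc.IH[of "dx f" "dx g"] Suc.IH[of "dy f" "dy g"] Suc.prems
      dx_cong[OF \<open>open U\<close>, of _ f g] dy_cong[OF \<open>open U\<close>, of _ f g] by auto
  ultimately show ?case by simp
qed

text \<open>The base case is that differentiability implies continuity. The product rule needs this,
  as each of its terms keeps one factor undifferentiated.\<close>

lemma Ck_on_SucD: "Ck_on (Suc k) U f \<Longrightarrow> Ck_on k U f"
proof (induction k arbitrary: f)
  case 0
  then show ?case by (simp add: differentiable_imp_continuous_on)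
next
  case (Suc k)
  have "f differentiable_on U" "Ck_on (Suc k) U (dx f)" "Ck_on (Suc k) U (dy f)"
    using Suc.prems by (simp_all only: Ck_on.simps)
  from this(1) Suc.IH[OF this(2)] Suc.IH[OF this(3)] show ?case by simp
qed

lemma dx_mult:
  fixes f g :: "real \<times> real \<Rightarrow> real"
  assumes "f differentiable (at p)" "g differentiable (at p)"
  shows "dx (\<lambda>q. f q * g q) p = f p * dx g p + dx f p * g p"
  using has_vector_derivative_mult[OF has_dx[OF assms(1)] has_dx[OF assms(2)]]
  by (simp add: dx_eqI)

lemma dy_mult:
  fixes f g :: "real \<times> real \<Rightarrow> real"
  assumes "f differentiable (at p)" "g differentiable (at p)"
  shows "dy (\<lambda>q. f q * g q) p = f p * dy g p + dy f p * g p"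
  using has_vector_derivative_mult[OF has_dy[OF assms(1)] has_dy[OF assms(2)]]
  by (simp add: dy_eqI)

lemma Ck_on_add:
  fixes f g :: "real \<times> real \<Rightarrow> real"
  assumes "open U" "Ck_on k U f" "Ck_on k U g"
  shows "Ck_on k U (\<lambda>q. f q + g q)"
  using assms(2,3)
proof (induction k arbitrary: f g)
  case 0
  then show ?case by (auto intro: continuous_on_add)
next
  case (Suc k)
  have d: "f differentiable (at p)" "g differentiable (at p)" if "p \<in> U" for p
    using Suc.prems that assms(1) by (auto intro: differentiable_on_openD)
  have e: "dx (\<lambda>q. f q + g q) p = dx f p + dx g p" "dy (\<lambda>q. f q + g q) p = dy f p + dy g p" if "p \<in> U" for p
    by (rule dx_eqI dy_eqI, rule has_vector_derivative_add; (rule has_dx has_dy, rule d, rule that))+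
  have "Ck_on k U (\<lambda>p. dx f p + dx g p)" "Ck_on k U (\<lambda>p. dy f p + dy g p)"
    using Suc.prems by (auto intro!: Suc.IH)
  then have "Ck_on k U (dx (\<lambda>q. f q + g q))" "Ck_on k U (dy (\<lambda>q. f q + g q))"
    by - (rule Ck_on_cong[OF assms(1) e(1)[symmetric]] Ck_on_cong[OF assms(1) e(2)[symmetric]], assumption+)+
  then show ?case using Suc.prems by (auto intro: differentiable_on_add)
qed

lemma Ck_on_mult:
  fixes f g :: "real \<times> real \<Rightarrow> real"
  assumes "open U" "Ck_on k U f" "Ck_on k U g"
  shows "Ck_on k U (\<lambda>q. f q * g q)"
  using assms(2,3)
proof (induction k arbitrary: f g)
  case 0
  then show ?case by (auto intro: continuous_on_mult)
next
  case (Suc k)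
  have d: "f differentiable (at p)" "g differentiable (at p)" if "p \<in> U" for p
    using Suc.prems that assms(1) by (auto intro: differentiable_on_openD)
  have "Ck_on k U (\<lambda>p. f p * dx g p + dx f p * g p)" "Ck_on k U (\<lambda>p. f p * dy g p + dy f p * g p)"
    using Suc.prems Ck_on_SucD[of k U f] Ck_on_SucD[of k U g]
    by (auto intro!: Ck_on_add[OF assms(1)] Suc.IH)
  then have "Ck_on k U (dx (\<lambda>q. f q * g q))" "Ck_on k U (dy (\<lambda>q. f q * g q))"
    by - (rule Ck_on_cong[OF assms(1) dx_mult[OF d, symmetric]] Ck_on_cong[OF assms(1) dy_mult[OF d, symmetric]],
        assumption+)+
  then show ?case using Suc.prems by (auto intro: differentiable_on_mult)
qed

lemma Ck_on_const: "Ck_on k U (\<lambda>q. c)"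
proof (induction k arbitrary: c)
  case (Suc k)
  have "dx (\<lambda>q. c) = (\<lambda>q. 0)" "dy (\<lambda>q. c) = (\<lambda>q. 0)"
    by (auto simp: dx_def dy_def)
  with Suc show ?case by simp
qed simp

text \<open>Both functions are treated in one induction because the derivative of each involves the
  other.\<close>

lemma Ck_on_sin_cos:
  fixes f :: "real \<times> real \<Rightarrow> real"
  assumes "open U" "Ck_on k U f"
  shows "Ck_on k U (\<lambda>q. sin (f q)) \<and> Ck_on k U (\<lambda>q. cos (f q))"
  using assms(2)
proof (induction k)
  case 0
  then show ?case by (auto intro: continuous_intros)
next
  case (Suc k)
  have d: "f differentiable (at p)" if "p \<in> U" for p
    using Suc.prems that assms(1) by (auto intro: differentiable_on_openD)
  \<comment> \<open>The sign is written as a constant factor so that closure under constants and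
    products covers all four formulas.\<close>
  have e: "dx (\<lambda>q. sin (f q)) p = cos (f p) * dx f p" "dy (\<lambda>q. sin (f q)) p = cos (f p) * dy f p"
    "dx (\<lambda>q. cos (f q)) p = (-1) * (sin (f p) * dx f p)" "dy (\<lambda>q. cos (f q)) p = (-1) * (sin (f p) * dy f p)"
    if "p \<in> U" for p
    using has_dx[OF d[OF that]] has_dy[OF d[OF that]]
    by (auto intro!: dx_eqI dy_eqI derivative_eq_intros
        simp flip: has_real_derivative_iff_has_vector_derivative)
  have IH: "Ck_on k U (\<lambda>q. sin (f q))" "Ck_on k U (\<lambda>q. cos (f q))" and f: "Ck_on k U (dx f)" "Ck_on k U (dy f)"
    using Suc.IH[OF Ck_on_SucD[OF Suc.prems]] Suc.prems by auto
  have "Ck_on k U (dx (\<lambda>q. sin (f q)))" "Ck_on k U (dy (\<lambda>q. sin (f q)))"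
    "Ck_on k U (dx (\<lambda>q. cos (f q)))" "Ck_on k U (dy (\<lambda>q. cos (f q)))"
    by (rule Ck_on_cong[OF assms(1) e(1)[symmetric]] Ck_on_cong[OF assms(1) e(2)[symmetric]]
        Ck_on_cong[OF assms(1) e(3)[symmetric]] Ck_on_cong[OF assms(1) e(4)[symmetric]],
        assumption, intro Ck_on_mult assms(1) Ck_on_const IH f)+
  moreover have "(\<lambda>q. sin (f q)) differentiable (at p)" "(\<lambda>q. cos (f q)) differentiable (at p)" if "p \<in> U" for p
    using d[OF that] unfolding differentiable_def by (metis has_derivative_sin, metis has_derivative_cos)
  ultimately show ?case
    by (simp add: differentiable_on_eq_differentiable_at assms(1))
qed

text \<open>Serves for bootstrapping: a differentiable function whose two partial derivatives are
  smooth is itself smooth.\<close>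

lemma smooth_on_iff:
  "smooth_on U f \<longleftrightarrow> f differentiable_on U \<and> smooth_on U (dx f) \<and> smooth_on U (dy f)"
proof
  show "smooth_on U f \<Longrightarrow> f differentiable_on U \<and> smooth_on U (dx f) \<and> smooth_on U (dy f)"
    unfolding smooth_on_def by (metis Ck_on.simps(2))
next
  assume f: "f differentiable_on U \<and> smooth_on U (dx f) \<and> smooth_on U (dy f)"
  then have "Ck_on k U f" for k
    by (cases k) (auto simp: smooth_on_def differentiable_imp_continuous_on)
  then show "smooth_on U f" by (simp add: smooth_on_def)
qed

text \<open>Differentiate \<open>f (s, t) = f (s, b) + \<integral>\<^bsub>b\<^esub>\<^bsup>t\<^esup> f\<^sub>y (s, u) du\<close> first in \<open>s\<close>, under the integral, then in \<open>t\<close>.\<close>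

lemma dx_dy_commute:
  fixes f :: "real \<times> real \<Rightarrow> 'a::banach"
  assumes "open U" "Ck_on 2 U f" "p \<in> U"
  shows "dx (dy f) p = dy (dx f) p"
proof -
  obtain x y where p: "p = (x, y)" by (cases p)
  have f: "f differentiable_on U" "dx f differentiable_on U" "dy f differentiable_on U"
    "continuous_on U (dx (dy f))" "continuous_on U (dy f)"
    using assms(2) by (auto simp: numeral_2_eq_2 intro: differentiable_imp_continuous_on)
  note D = differentiable_on_openD[OF _ \<open>open U\<close>]
  \<comment> \<open>A closed rectangle around \<open>p\<close> inside \<open>U\<close> is chosen;
    its lower edge \<open>y - e\<close> is the base point of the integration in the second
    variable.\<close>
  obtain A B where AB: "open A" "open B" "p \<in> A \<times> B" "A \<times> B \<subseteq> U"
    using open_prod_elim[OF assms(1,3)] by metis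
  obtain d where d: "d > 0" "cball x d \<subseteq> A" using AB p by (auto simp: open_contains_cball)
  obtain e where e: "e > 0" "cball y e \<subseteq> B" using AB p by (auto simp: open_contains_cball)
  have f_y: "((\<lambda>u. f (s, u)) has_vector_derivative dy f (s, u)) (at u within T)" if "(s, u) \<in> U" for s u T
    using has_vector_derivative_at_within[OF has_dy[OF D[OF f(1) that]]] by simp
  have f_x: "((\<lambda>s. f (s, u)) has_vector_derivative dx f (s, u)) (at s within T)" if "(s, u) \<in> U" for s u T
    using has_vector_derivative_at_within[OF has_dx[OF D[OF f(1) that]]] by simp
  have f_yx: "((\<lambda>s. dy f (s, u)) has_vector_derivative dx (dy f) (s, u)) (at s within T)" if "(s, u) \<in> U" for s u T
    using has_vector_derivative_at_within[OF has_dx[OF D[OF f(3) that]]] by simp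
  let ?I = "{x - d..x + d}" and ?J = "{y - e..y + e}"
  have inU: "(s, t) \<in> U" if "s \<in> ?I" "t \<in> ?J" for s t
  proof -
    have "s \<in> A" "t \<in> B"
      using d(2) e(2) that by (auto simp: cball_eq_atLeastAtMost)
    then show ?thesis using AB(4) by blast
  qed
  have f_eq: "f (s, t) = f (s, y - e) + integral {y - e..t} (\<lambda>u. dy f (s, u))"
    if s: "s \<in> ?I" and t: "t \<in> ?J" for s t
  proof -
    have "((\<lambda>u. dy f (s, u)) has_integral f (s, t) - f (s, y - e)) {y - e..t}"
      using s t by (intro fundamental_theorem_of_calculus f_y inU) auto
    then show ?thesis by (simp add: integral_unique)
  qed
  have xI: "x \<in> ?I" "y \<in> ?J" using d e by auto
  have dx_eq: "dx f (x, t) = dx f (x, y - e) + integral {y - e..t} (\<lambda>u. dx (dy f) (x, u))"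
    if t: "t \<in> ?J" for t
  proof -
    have int: "((\<lambda>s. integral (cbox (y - e) t) (\<lambda>u. dy f (s, u))) has_vector_derivative
        integral (cbox (y - e) t) (\<lambda>u. dx (dy f) (x, u))) (at x within ?I)"
    proof (rule leibniz_rule_vector_derivative[where fx = "\<lambda>s u. dx (dy f) (s, u)"])
      fix s u assume "s \<in> ?I" "u \<in> cbox (y - e) t"
      with t show "((\<lambda>s. dy f (s, u)) has_vector_derivative dx (dy f) (s, u)) (at s within ?I)"
        by (intro f_yx inU) auto
    next
      fix s assume "s \<in> ?I"
      with t show "(\<lambda>u. dy f (s, u)) integrable_on cbox (y - e) t"
        by - (rule integrable_continuous, rule continuous_on_compose2[OF f(5)],
            auto intro!: inU continuous_intros)
    next
      show "continuous_on (?I \<times> cbox (y - e) t) (\<lambda>(s, u). dx (dy f) (s, u))"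
        using t by (auto intro!: continuous_on_subset[OF f(4)] inU)
    qed (use xI in auto)
    have "((\<lambda>s. f (s, y - e)) has_vector_derivative dx f (x, y - e)) (at x within ?I)"
      using xI e by (intro f_x inU) auto
    from has_vector_derivative_add[OF this int]
    have "((\<lambda>s. f (s, y - e) + integral (cbox (y - e) t) (\<lambda>u. dy f (s, u))) has_vector_derivative
        dx f (x, y - e) + integral (cbox (y - e) t) (\<lambda>u. dx (dy f) (x, u))) (at x within ?I)" .
    then have "((\<lambda>s. f (s, t)) has_vector_derivative
        dx f (x, y - e) + integral (cbox (y - e) t) (\<lambda>u. dx (dy f) (x, u))) (at x within ?I)"
      by (rule has_vector_derivative_transform[OF xI(1), rotated]) (use f_eq[OF _ t] in \<open>simp only: cbox_interval\<close>)
    moreover have "at x within ?I = at x" using d by (intro at_within_interior) auto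
    ultimately show ?thesis using dx_eqI[of f "(x, t)"] by simp
  qed
  have cJ: "continuous_on ?J (\<lambda>u. dx (dy f) (x, u))"
    by (rule continuous_on_compose2[OF f(4)]) (use xI(1) inU in \<open>auto intro!: continuous_intros\<close>)
  have "((\<lambda>t. dx f (x, y - e) + integral {y - e..t} (\<lambda>u. dx (dy f) (x, u))) has_vector_derivative
      0 + dx (dy f) (x, y)) (at y within ?J)"
    by (rule has_vector_derivative_add[OF has_vector_derivative_const
          integral_has_vector_derivative[OF cJ xI(2)]])
  then have "((\<lambda>t. dx f (x, t)) has_vector_derivative 0 + dx (dy f) (x, y)) (at y within ?J)"
    by (rule has_vector_derivative_transform[OF xI(2), rotated]) (rule dx_eq)
  moreover have "at y within ?J = at y" using e by (intro at_within_interior) auto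
  ultimately show ?thesis using dy_eqI[of "dx f" p] p by simp
qed

text \<open>After identification of the plane with the complex numbers, the field
  \<open>(P, R)\<close> has a symmetric derivative exactly when its cross partials agree, so the
  potential of that field is the primitive.\<close>

lemma closed_form_primitive:
  fixes P R :: "real \<times> real \<Rightarrow> real"
  assumes U: "open U" "simply_connected U"
    and P: "Ck_on 1 U P" and R: "Ck_on 1 U R"
    and closed: "\<And>p. p \<in> U \<Longrightarrow> dy P p = dx R p"
  shows "\<exists>Q. Q differentiable_on U \<and> (\<forall>p\<in>U. dx Q p = P p \<and> dy Q p = R p)"
proof -
  define c where "c p = Complex (fst p) (snd p)" for p
  define e where "e z = (Re z, Im z)" for z
  have ce [simp]: "c (e z) = z" "e (c p) = p" for z p by (simp_all add: c_def e_def)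
  have cont: "continuous_on A c" "continuous_on B e" for A B
    unfolding c_def e_def Complex_eq by (intro continuous_intros)+
  have de: "(e has_derivative e) (at z)" for z
    unfolding e_def by (auto intro!: derivative_eq_intros)
  have dc: "(c has_derivative c) (at p)" for p
    unfolding c_def Complex_eq by (auto intro!: derivative_eq_intros)
  let ?S = "e -` U"
  have oS: "open ?S" using open_vimage[OF U(1) cont(2)] .
  \<comment> \<open>Simple connectedness is a topological invariant and is thereby carried to the
    complex copy \<open>?S\<close> of \<open>U\<close>.\<close>
  have "homeomorphism U ?S c e"
    unfolding homeomorphism_def using cont
    by (auto simp: image_iff simp del: ce) (metis ce)+
  then have sS: "simply_connected ?S"
    using homeomorphic_simply_connected[OF _ U(2)] unfolding homeomorphic_def by blast
  have d: "P differentiable (at p)" "R differentiable (at p)" if "p \<in> U" for p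
    using P R that U(1) by (auto intro: differentiable_on_openD)
  have k: "continuous_on U (dx P)" "continuous_on U (dy P)" "continuous_on U (dx R)" "continuous_on U (dy R)"
    using P R by auto
  let ?V = "\<lambda>z. c (P (e z), R (e z))"
  let ?V' = "\<lambda>z a. c (fst (e a) *\<^sub>R dx P (e z) + snd (e a) *\<^sub>R dy P (e z), fst (e a) *\<^sub>R dx R (e z) + snd (e a) *\<^sub>R dy R (e z))"
  have "\<exists>F. \<forall>z\<in>?S. (F has_derivative (\<lambda>h. ?V z \<bullet> h)) (at z)"
  proof (rule curl_free_simply_connected_potential_complex[OF oS sS])
    fix z assume z: "z \<in> ?S"
    have "((\<lambda>p. (P p, R p)) has_derivative (\<lambda>h. (fst h *\<^sub>R dx P (e z) + snd h *\<^sub>R dy P (e z),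
        fst h *\<^sub>R dx R (e z) + snd h *\<^sub>R dy R (e z)))) (at (e z))"
      using z by (intro has_derivative_Pair has_derivative_dx_dy d) auto
    from has_derivative_compose[OF has_derivative_compose[OF de this] dc]
    show "(?V has_derivative ?V' z) (at z)" .
    show "?V' z a \<bullet> b = ?V' z b \<bullet> a" for a b
      using closed[of "e z"] z by (simp add: c_def e_def inner_complex_def algebra_simps)
  next
    fix a
    have "continuous_on ?S (\<lambda>z. g (e z))" if "continuous_on U g" for g :: "real \<times> real \<Rightarrow> real"
      by (rule continuous_on_compose2[OF that cont(2)]) auto
    note this[OF k(1)] this[OF k(2)] this[OF k(3)] this[OF k(4)]
    then show "continuous_on ?S (\<lambda>z. ?V' z a)"
      unfolding c_def Complex_eq fst_conv snd_conv by (intro continuous_intros)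
  qed
  then obtain F where F: "\<And>z. e z \<in> U \<Longrightarrow> (F has_derivative (\<lambda>h. ?V z \<bullet> h)) (at z)"
    by auto
  have Q: "((\<lambda>p. F (c p)) has_derivative (\<lambda>h. ?V (c p) \<bullet> c h)) (at p)" if "p \<in> U" for p
    using has_derivative_compose[OF dc F[of "c p"]] that by simp
  then have "(\<lambda>p. F (c p)) differentiable_on U"
    using differentiable_on_eq_differentiable_at[OF U(1)] differentiable_def by blast
  moreover have "dx (\<lambda>p. F (c p)) p = P p \<and> dy (\<lambda>p. F (c p)) p = R p" if "p \<in> U" for p
    using dx_dy_of_has_derivative[OF Q[OF that]] by (simp add: c_def inner_complex_def e_def)
  ultimately show ?thesis by blast
qed

section \<open>Differentiation rules and functions with equal partial derivatives\<close>

lemma dx_inner: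
  fixes f g :: "real \<times> real \<Rightarrow> 'a::real_inner"
  assumes "f differentiable (at p)" "g differentiable (at p)"
  shows "dx (\<lambda>q. f q \<bullet> g q) p = f p \<bullet> dx g p + dx f p \<bullet> g p"
  by (rule dx_eqI)
     (use bounded_bilinear.has_vector_derivative[OF bounded_bilinear_inner has_dx[OF assms(1)] has_dx[OF assms(2)]] in simp)

lemma dy_inner:
  fixes f g :: "real \<times> real \<Rightarrow> 'a::real_inner"
  assumes "f differentiable (at p)" "g differentiable (at p)"
  shows "dy (\<lambda>q. f q \<bullet> g q) p = f p \<bullet> dy g p + dy f p \<bullet> g p"
  by (rule dy_eqI)
     (use bounded_bilinear.has_vector_derivative[OF bounded_bilinear_inner has_dy[OF assms(1)] has_dy[OF assms(2)]] in simp)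

lemma has_real_dx:
  fixes f :: "real \<times> real \<Rightarrow> real"
  assumes "f differentiable (at p)"
  shows "((\<lambda>t. f (t, snd p)) has_real_derivative dx f p) (at (fst p))"
  using has_dx[OF assms] by (simp add: has_real_derivative_iff_has_vector_derivative)

lemma has_real_dy:
  fixes f :: "real \<times> real \<Rightarrow> real"
  assumes "f differentiable (at p)"
  shows "((\<lambda>t. f (fst p, t)) has_real_derivative dy f p) (at (snd p))"
  using has_dy[OF assms] by (simp add: has_real_derivative_iff_has_vector_derivative)

lemma dx_dy_const: "dx (\<lambda>q. c) p = 0" "dy (\<lambda>q. c) p = 0"
  by (auto simp: dx_def dy_def)

lemma dx_dy_cos:
  fixes f :: "real \<times> real \<Rightarrow> real"
  assumes "f differentiable (at p)"
  shows "dx (\<lambda>q. cos (f q)) p = - sin (f p) * dx f p" "dy (\<lambda>q. cos (f q)) p = - sin (f p) * dy f p"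
  by (rule dx_eqI dy_eqI; use has_real_dx[OF assms] has_real_dy[OF assms] in
      \<open>auto intro!: derivative_eq_intros simp flip: has_real_derivative_iff_has_vector_derivative\<close>)+

lemma dx_dy_sin:
  fixes f :: "real \<times> real \<Rightarrow> real"
  assumes "f differentiable (at p)"
  shows "dx (\<lambda>q. sin (f q)) p = cos (f p) * dx f p" "dy (\<lambda>q. sin (f q)) p = cos (f p) * dy f p"
  by (rule dx_eqI dy_eqI; use has_real_dx[OF assms] has_real_dy[OF assms] in
      \<open>auto intro!: derivative_eq_intros simp flip: has_real_derivative_iff_has_vector_derivative\<close>)+

lemma smooth_on_differentiable: "smooth_on U f \<Longrightarrow> open U \<Longrightarrow> p \<in> U \<Longrightarrow> f differentiable (at p)"
  by (metis smooth_on_iff differentiable_on_openD)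

lemma smooth_on_dx: "smooth_on U f \<Longrightarrow> smooth_on U (dx f)"
  and smooth_on_dy: "smooth_on U f \<Longrightarrow> smooth_on U (dy f)"
  by (metis smooth_on_iff)+

lemma smooth_dx_dy_commute:
  fixes f :: "real \<times> real \<Rightarrow> 'a::banach"
  shows "smooth_on U f \<Longrightarrow> open U \<Longrightarrow> p \<in> U \<Longrightarrow> dx (dy f) p = dy (dx f) p"
  by (rule dx_dy_commute) (auto simp: smooth_on_def)

text \<open>The total derivative is assembled from the two partials, so that of \<open>f - g\<close>
  vanishes on a connected open set.\<close>

lemma equal_partials_differ_by_const:
  fixes f g :: "real \<times> real \<Rightarrow> 'a::real_normed_vector"
  assumes U: "open U" "connected U"
    and diff: "\<And>p. p \<in> U \<Longrightarrow> f differentiable (at p)" "\<And>p. p \<in> U \<Longrightarrow> g differentiable (at p)"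
    and eq: "\<And>p. p \<in> U \<Longrightarrow> dx f p = dx g p" "\<And>p. p \<in> U \<Longrightarrow> dy f p = dy g p"
  shows "\<exists>c. \<forall>p\<in>U. f p = g p + c"
proof (cases "U = {}")
  case False
  then obtain p0 where p0: "p0 \<in> U" by blast
  have "((\<lambda>q. f q - g q) has_derivative (\<lambda>h. 0)) (at p)" if "p \<in> U" for p
    using has_derivative_diff[OF has_derivative_dx_dy[OF diff(1)[OF that]] has_derivative_dx_dy[OF diff(2)[OF that]]]
    by (simp add: eq that)
  then have "f p - g p = f p0 - g p0" if "p \<in> U" for p
    using has_derivative_zero_unique_connected[OF U, of "\<lambda>q. f q - g q" p p0] that p0 by blast
  then have "\<forall>p\<in>U. f p = g p + (f p0 - g p0)" by (metis add.commute diff_add_cancel)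
  then show ?thesis by blast
qed simp

lemma smooth_on_const: "smooth_on U (\<lambda>q. c)"
  by (simp add: smooth_on_def Ck_on_const)

subsection \<open>Pseudospherical surfaces\<close>

text \<open>Otherwise \<open>v\<close>, \<open>n\<close>, \<open>a\<close> and the Gram-Schmidt
  vector \<open>e\<close>, of squared length \<open>1 - (a \<bullet> b)\<^sup>2\<close>, would be
  four nonzero pairwise orthogonal vectors in dimension three.\<close>

lemma frame_orthogonal_eq_0:
  fixes a b n v :: "real^3"
  assumes "a \<bullet> a = 1" "b \<bullet> b = 1" "(a \<bullet> b)\<^sup>2 \<noteq> 1" "n \<bullet> n = 1" "n \<bullet> a = 0" "n \<bullet> b = 0"
    and v: "v \<bullet> a = 0" "v \<bullet> b = 0" "v \<bullet> n = 0"
  shows "v = 0"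
proof (rule ccontr)
  assume "v \<noteq> 0"
  define e where "e = b - (a \<bullet> b) *\<^sub>R a"
  have inner: "a \<bullet> e = 0" "n \<bullet> e = 0" "v \<bullet> e = 0" "e \<bullet> e = 1 - (a \<bullet> b)\<^sup>2"
    using assms by (simp_all add: e_def inner_diff_left inner_diff_right inner_commute power2_eq_square)
  then have "e \<noteq> 0" using assms(3) by auto
  moreover have "a \<noteq> 0" "n \<noteq> 0" using assms by auto
  \<comment> \<open>Distinctness ensures that the set has four elements, which contradicts the
    dimension bound.\<close>
  moreover have "distinct [a, e, n, v]"
    using assms inner \<open>v \<noteq> 0\<close> \<open>e \<noteq> 0\<close> by (auto simp: inner_commute)
  moreover have "pairwise orthogonal {a, e, n, v}"
    using assms inner by (auto simp: pairwise_def orthogonal_def inner_commute)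
  ultimately have "independent {a, e, n, v}" "card {a, e, n, v} = 4"
    using \<open>v \<noteq> 0\<close> by (simp_all add: pairwise_orthogonal_independent)
  then show False using independent_bound[of "{a, e, n, v}"] by simp
qed

text \<open>The fundamental forms supply inner products, so vector identities are verified by
  pairing with the frame.\<close>

lemma frame_eqI:
  fixes a b n v w :: "real^3"
  assumes "a \<bullet> a = 1" "b \<bullet> b = 1" "(a \<bullet> b)\<^sup>2 \<noteq> 1" "n \<bullet> n = 1" "n \<bullet> a = 0" "n \<bullet> b = 0"
    and "v \<bullet> a = w \<bullet> a" "v \<bullet> b = w \<bullet> b" "v \<bullet> n = w \<bullet> n"
  shows "v = w"
  using frame_orthogonal_eq_0[of a b n "v - w"] assms by (simp add: inner_diff_left)

text \<open>Covers both coordinate directions: along \<open>x\<close> take \<open>(a, b) = (r\<^sub>x, r\<^sub>y)\<close> and \<open>(u, v) = (\<Phi>\<^sub>x, \<Phi>\<^sub>y)\<close>,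
  along \<open>y\<close> swap both pairs.\<close>

lemma voss_curve_derivative:
  fixes a b n :: "real \<Rightarrow> real^3" and \<phi> F u v :: "real \<Rightarrow> real"
  assumes a: "(a has_vector_derivative a') (at t)" and b: "(b has_vector_derivative b') (at t)"
    and n: "(n has_vector_derivative n') (at t)" and \<phi>: "(\<phi> has_real_derivative \<phi>') (at t)"
    and F: "(F has_real_derivative u t) (at t)" and u: "(u has_real_derivative u') (at t)"
    and v: "(v has_real_derivative F t * cos (\<phi> t)) (at t)"
    and s: "sin (\<phi> t) \<noteq> 0"
    and frame: "a t \<bullet> a t = 1" "b t \<bullet> b t = 1" "a t \<bullet> b t = cos (\<phi> t)"
      "n t \<bullet> n t = 1" "n t \<bullet> a t = 0" "n t \<bullet> b t = 0"
    and a': "a' \<bullet> a t = 0" "a' \<bullet> b t = - sin (\<phi> t) * \<phi>'" "a' \<bullet> n t = 0"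
    and b': "b' \<bullet> a t = 0" "b' \<bullet> b t = 0" "b' \<bullet> n t = sin (\<phi> t)"
    and n': "n' \<bullet> a t = 0" "n' \<bullet> b t = - sin (\<phi> t)" "n' \<bullet> n t = 0"
  defines "X \<equiv> u' + F t - (u t * cos (\<phi> t) / sin (\<phi> t) + v t / sin (\<phi> t)) * \<phi>'"
  shows "((\<lambda>t. F t *\<^sub>R n t - (1 / sin (\<phi> t)) *\<^sub>R (v t *\<^sub>R a t + u t *\<^sub>R b t))
           has_vector_derivative (- X / sin (\<phi> t)) *\<^sub>R b t) (at t)"
proof -
  let ?s = "sin (\<phi> t)" and ?c = "cos (\<phi> t)"
  have c2: "?c * ?c = 1 - ?s * ?s"
    using sin_cos_squared_add[of "\<phi> t"] by (simp add: power2_eq_square)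
  have "((\<lambda>t. 1 / sin (\<phi> t)) has_real_derivative - (?c * \<phi>') / (?s * ?s)) (at t)"
    using \<phi> s by (auto intro!: derivative_eq_intros)
  note D = has_vector_derivative_diff[OF has_vector_derivative_scaleR[OF F n]
      has_vector_derivative_scaleR[OF this has_vector_derivative_add[OF
        has_vector_derivative_scaleR[OF v a] has_vector_derivative_scaleR[OF u b]]]]
  have "(a t \<bullet> b t)\<^sup>2 \<noteq> 1"
    using s c2 unfolding frame by (simp add: power2_eq_square)
  note eqI = frame_eqI[OF frame(1,2) this frame(4-6)]
  note inner = frame a' b' n' inner_commute[of "b t" "a t"] inner_commute[of "a t" "n t"] inner_commute[of "b t" "n t"]
  show ?thesis
    \<comment> \<open>Pairing with \<open>a\<close>, \<open>b\<close> and \<open>n\<close> turns the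
      claim into three scalar identities. Once the denominators are cleared, they follow from
      \<open>c2\<close>.\<close>
    by (rule has_vector_derivative_eq_rhs[OF D], rule eqI; unfold X_def inner_diff_left inner_add_left inner_scaleR_left inner;
        use s in \<open>simp add: field_simps\<close>; use c2 in algebra)
qed

locale dini_surface =
  fixes U :: "(real \<times> real) set" and \<phi> :: "real \<times> real \<Rightarrow> real" and r n :: "real \<times> real \<Rightarrow> real^3"
  assumes open_U: "open U" and dini: "pseudospherical_dini U \<phi> r n"
begin

lemma smooth: "smooth_on U \<phi>" "smooth_on U r" "smooth_on U n"
  "smooth_on U (dx r)" "smooth_on U (dy r)" "smooth_on U (dx \<phi>)"
  using dini unfolding pseudospherical_dini_def by (auto intro: smooth_on_dx smooth_on_dy)

lemmas diff = smooth[THEN smooth_on_differentiable, OF open_U]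

lemma sin_nonzero: "p \<in> U \<Longrightarrow> sin (\<phi> p) \<noteq> 0"
  using dini unfolding pseudospherical_dini_def by blast

lemma frame:
  assumes "p \<in> U"
  shows "dx r p \<bullet> dx r p = 1" "dy r p \<bullet> dy r p = 1" "dx r p \<bullet> dy r p = cos (\<phi> p)"
    "n p \<bullet> n p = 1" "n p \<bullet> dx r p = 0" "n p \<bullet> dy r p = 0"
  using dini assms unfolding pseudospherical_dini_def by (auto simp: dot_square_norm)

lemma second_form:
  assumes "p \<in> U"
  shows "dx (dx r) p \<bullet> n p = 0" "dy (dx r) p \<bullet> n p = sin (\<phi> p)" "dy (dy r) p \<bullet> n p = 0"
  using dini assms unfolding pseudospherical_dini_def by auto

text \<open>The determinant of the first fundamental form is
  \<open>1 - (cos (\<phi> p))\<^sup>2 = (sin (\<phi> p))\<^sup>2\<close>.\<close>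

lemma cos_frame_nondegenerate: "p \<in> U \<Longrightarrow> (dx r p \<bullet> dy r p)\<^sup>2 \<noteq> 1"
  using sin_nonzero[of p] sin_cos_squared_add[of "\<phi> p"] by (auto simp: frame simp del: sin_cos_squared_add)

lemma surface_frame_eqI:
  assumes "p \<in> U" "v \<bullet> dx r p = w \<bullet> dx r p" "v \<bullet> dy r p = w \<bullet> dy r p" "v \<bullet> n p = w \<bullet> n p"
  shows "v = w"
  using frame_eqI[OF frame(1,2) cos_frame_nondegenerate frame(4-6)] assms by blast

section \<open>Gauss and Weingarten equations, and the sine-Gordon equation\<close>

lemma dx_dy_r: "p \<in> U \<Longrightarrow> dx (dy r) p = dy (dx r) p"
  using smooth_dx_dy_commute[OF smooth(2) open_U] .

text \<open>The source of the tables of inner products below: a frame relation valid on all of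
  \<open>U\<close> is differentiated by the product rule.\<close>

lemma dx_inner_eq:
  fixes f g :: "real \<times> real \<Rightarrow> real^3"
  assumes "p \<in> U" "smooth_on U f" "smooth_on U g" "\<And>q. q \<in> U \<Longrightarrow> f q \<bullet> g q = h q"
  shows "f p \<bullet> dx g p + dx f p \<bullet> g p = dx h p"
  using dx_cong[OF open_U assms(1,4), symmetric]
    dx_inner[OF smooth_on_differentiable[OF assms(2) open_U assms(1)] smooth_on_differentiable[OF assms(3) open_U assms(1)]]
  by simp

lemma dy_inner_eq:
  fixes f g :: "real \<times> real \<Rightarrow> real^3"
  assumes "p \<in> U" "smooth_on U f" "smooth_on U g" "\<And>q. q \<in> U \<Longrightarrow> f q \<bullet> g q = h q"
  shows "f p \<bullet> dy g p + dy f p \<bullet> g p = dy h p"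
  using dy_cong[OF open_U assms(1,4), symmetric]
    dy_inner[OF smooth_on_differentiable[OF assms(2) open_U assms(1)] smooth_on_differentiable[OF assms(3) open_U assms(1)]]
  by simp

text \<open>The unit length of \<open>dx r\<close> is differentiated in \<open>y\<close>, that of
  \<open>dy r\<close> in \<open>x\<close>; both bring in the same mixed derivative.\<close>

lemma inner_rxy:
  assumes p: "p \<in> U"
  shows "dy (dx r) p \<bullet> dx r p = 0" "dy (dx r) p \<bullet> dy r p = 0"
  using dy_inner_eq[OF p smooth(4) smooth(4) frame(1)] dx_inner_eq[OF p smooth(5) smooth(5) frame(2)]
  by (simp_all add: dx_dy_const dx_dy_r[OF p] inner_commute)

lemma inner_rxx:
  assumes p: "p \<in> U"
  shows "dx (dx r) p \<bullet> dx r p = 0" "dx (dx r) p \<bullet> dy r p = - sin (\<phi> p) * dx \<phi> p"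
  using dx_inner_eq[OF p smooth(4) smooth(4) frame(1)] dx_inner_eq[OF p smooth(4) smooth(5) frame(3)]
  by (simp_all add: dx_dy_const dx_dy_r[OF p] dx_dy_cos diff(1)[OF p] inner_rxy[OF p]
      inner_commute[of "dx r p"])

lemma inner_ryy:
  assumes p: "p \<in> U"
  shows "dy (dy r) p \<bullet> dy r p = 0" "dy (dy r) p \<bullet> dx r p = - sin (\<phi> p) * dy \<phi> p"
  using dy_inner_eq[OF p smooth(5) smooth(5) frame(2)] dy_inner_eq[OF p smooth(4) smooth(5) frame(3)]
  by (simp_all add: dx_dy_const dx_dy_cos diff(1)[OF p] inner_rxy[OF p]
      inner_commute[of "dx r p"] inner_commute[of "dy r p"])

text \<open>Differentiation of \<open>n \<bullet> dx r = 0\<close> and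
  \<open>n \<bullet> dy r = 0\<close> moves the derivative onto \<open>n\<close>, giving the
  coefficients of the second form with the opposite sign.\<close>

lemma inner_nx:
  assumes p: "p \<in> U"
  shows "dx n p \<bullet> dx r p = 0" "dx n p \<bullet> dy r p = - sin (\<phi> p)" "dx n p \<bullet> n p = 0"
  using dx_inner_eq[OF p smooth(3) smooth(4) frame(5)] dx_inner_eq[OF p smooth(3) smooth(5) frame(6)]
    dx_inner_eq[OF p smooth(3) smooth(3) frame(4)] second_form[OF p]
  by (simp_all add: dx_dy_const dx_dy_r[OF p] inner_commute[of "n p"])

lemma inner_ny:
  assumes p: "p \<in> U"
  shows "dy n p \<bullet> dy r p = 0" "dy n p \<bullet> dx r p = - sin (\<phi> p)" "dy n p \<bullet> n p = 0"
  using dy_inner_eq[OF p smooth(3) smooth(4) frame(5)] dy_inner_eq[OF p smooth(3) smooth(5) frame(6)]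
    dy_inner_eq[OF p smooth(3) smooth(3) frame(4)] second_form[OF p]
  by (simp_all add: dx_dy_const inner_commute[of "n p"])

lemma rxy_eq: "p \<in> U \<Longrightarrow> dy (dx r) p = sin (\<phi> p) *\<^sub>R n p"
  by (rule surface_frame_eqI[of p]) (simp_all add: inner_rxy frame second_form)

lemma rxx_eq:
  assumes p: "p \<in> U"
  shows "dx (dx r) p = (dx \<phi> p * cos (\<phi> p) / sin (\<phi> p)) *\<^sub>R dx r p - (dx \<phi> p / sin (\<phi> p)) *\<^sub>R dy r p"
proof -
  have c2: "cos (\<phi> p) * cos (\<phi> p) = 1 - sin (\<phi> p) * sin (\<phi> p)"
    using sin_cos_squared_add[of "\<phi> p"] by (simp add: power2_eq_square)
  show ?thesis
    by (rule surface_frame_eqI[OF p]; unfold inner_diff_left inner_scaleR_left inner_rxx[OF p] second_form[OF p]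
        frame[OF p] inner_commute[of "dy r p" "dx r p"] inner_commute[of "dx r p" "n p"] inner_commute[of "dy r p" "n p"];
        use sin_nonzero[OF p] in \<open>simp add: field_simps\<close>; use c2 in algebra)
qed

text \<open>The compatibility condition \<open>r\<^sub>x\<^sub>x\<^sub>y = r\<^sub>x\<^sub>y\<^sub>x\<close>, tested against \<open>r\<^sub>y\<close>.\<close>

lemma sine_gordon:
  assumes p: "p \<in> U"
  shows "dy (dx \<phi>) p = sin (\<phi> p)"
proof -
  let ?s = "sin (\<phi> p)" and ?c = "cos (\<phi> p)"
  have "dx (dx r) p \<bullet> dy (dy r) p + dy (dx (dx r)) p \<bullet> dy r p = dy (\<lambda>q. (- 1) * (sin (\<phi> q) * dx \<phi> q)) p"
    by (rule dy_inner_eq[OF p smooth_on_dx[OF smooth(4)] smooth(5)]) (simp add: inner_rxx)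
  also have "\<dots> = - (?s * dy (dx \<phi>) p + ?c * dy \<phi> p * dx \<phi> p)"
  proof -
    have d: "(\<lambda>q. sin (\<phi> q)) differentiable (at p)" 
      using diff(1)[OF p] unfolding differentiable_def by (metis has_derivative_sin)
    show ?thesis
      using d diff(6)[OF p]
      by (subst dy_mult) (auto simp: dy_mult dx_dy_const dx_dy_sin diff(1)[OF p] intro: differentiable_mult)
  qed
  also have "dy (dx (dx r)) p = dx (dy (dx r)) p"
    using smooth_dx_dy_commute[OF smooth(4) open_U p] by simp
  also have "\<dots> = dx (\<lambda>q. sin (\<phi> q) *\<^sub>R n q) p"
    using dx_cong[OF open_U p rxy_eq] .
  also have "\<dots> = ?s *\<^sub>R dx n p + (?c * dx \<phi> p) *\<^sub>R n p"
    using has_real_dx[OF diff(1)[OF p]] has_dx[OF diff(3)[OF p]]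
    by (intro dx_eqI) (auto intro!: derivative_eq_intros)
  \<comment> \<open>By \<open>rxx_eq\<close>, the product of \<open>dx (dx r) p\<close> and
    \<open>dy (dy r) p\<close> is \<open>- ?c * dx \<phi> p * dy \<phi> p\<close>, which cancels the
    same term on the right. What remains comes from
    \<open>dx n p \<bullet> dy r p = - ?s\<close>.\<close>
  finally have "?s * dy (dx \<phi>) p = ?s * ?s"
    using sin_nonzero[OF p] inner_ryy[OF p]
    by (simp add: rxx_eq[OF p] inner_diff_left inner_add_left inner_nx[OF p] frame[OF p]
        inner_commute[of "dx r p" "dy (dy r) p"] inner_commute[of "dy r p" "dy (dy r) p"])
  then show ?thesis using sin_nonzero[OF p] by simp
qed

end

subsection \<open>The recursion operator\<close>

text \<open>For the zero solution an admissible \<open>Q\<close> has vanishing partials, so it is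
  constant on the connected set \<open>U\<close>.\<close>

lemma recursion_op_zero_iff:
  assumes "open U" "connected U"
  shows "g \<in> recursion_op U \<phi> (\<lambda>p. 0) \<longleftrightarrow> (\<exists>c. \<forall>p\<in>U. g p = dx \<phi> p * c)"
proof
  assume "g \<in> recursion_op U \<phi> (\<lambda>p. 0)"
  then obtain Q where Q: "smooth_on U Q" "\<And>p. p \<in> U \<Longrightarrow> dx Q p = 0" "\<And>p. p \<in> U \<Longrightarrow> dy Q p = 0"
    "\<And>p. p \<in> U \<Longrightarrow> g p = dx (dx (\<lambda>p. 0)) p + dx \<phi> p * Q p"
    unfolding recursion_op_def by (auto simp: dx_dy_const)
  have "\<exists>c. \<forall>p\<in>U. Q p = 0 + c"
    by (rule equal_partials_differ_by_const[OF assms])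
       (use Q assms in \<open>auto simp: dx_dy_const intro: smooth_on_differentiable\<close>)
  moreover have "dx (\<lambda>p. 0) = (\<lambda>p. 0::real)" by (auto simp: dx_dy_const)
  ultimately show "\<exists>c. \<forall>p\<in>U. g p = dx \<phi> p * c"
    using Q(4) by (auto simp: dx_dy_const)
next
  assume "\<exists>c. \<forall>p\<in>U. g p = dx \<phi> p * c"
  then obtain c where "\<forall>p\<in>U. g p = dx \<phi> p * c" by blast
  moreover have "dx (\<lambda>p. 0) = (\<lambda>p. 0::real)" by (auto simp: dx_dy_const)
  ultimately show "g \<in> recursion_op U \<phi> (\<lambda>p. 0)"
    unfolding recursion_op_def
    by (auto simp: dx_dy_const smooth_on_const intro!: exI[of _ "\<lambda>q. c"])
qed

text \<open>Collects the scalar data of the recursion operator: a sine-Gordon solution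
  \<open>\<phi>\<close> and a solution \<open>\<Phi>\<close> of the Moutard equation over
  it.\<close>

locale moutard =
  fixes U :: "(real \<times> real) set" and \<phi> \<Phi> :: "real \<times> real \<Rightarrow> real"
  assumes open_U: "open U" and smooth_phi: "smooth_on U \<phi>" and sin_nonzero: "p \<in> U \<Longrightarrow> sin (\<phi> p) \<noteq> 0"
    and sine_gordon: "p \<in> U \<Longrightarrow> dy (dx \<phi>) p = sin (\<phi> p)"
    and solution: "moutard_solution U \<phi> \<Phi>"
begin

lemma smooth_Phi: "smooth_on U \<Phi>" and Phi_xy: "p \<in> U \<Longrightarrow> dy (dx \<Phi>) p = \<Phi> p * cos (\<phi> p)"
  using solution by (auto simp: moutard_solution_def)

lemma Phi_yx: "p \<in> U \<Longrightarrow> dx (dy \<Phi>) p = \<Phi> p * cos (\<phi> p)"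
  using smooth_dx_dy_commute[OF smooth_Phi open_U] Phi_xy by simp

lemmas smooth = smooth_phi smooth_Phi smooth_on_dx[OF smooth_phi] smooth_on_dx[OF smooth_Phi]
  smooth_on_dy[OF smooth_Phi] smooth_on_dx[OF smooth_on_dx[OF smooth_Phi]]

lemmas diff = smooth[THEN smooth_on_differentiable, OF open_U]

lemma diff_sin_cos:
  assumes "p \<in> U"
  shows "(\<lambda>q. sin (\<phi> q)) differentiable (at p)" "(\<lambda>q. cos (\<phi> q)) differentiable (at p)"
  using diff(1)[OF assms] unfolding differentiable_def by (metis has_derivative_sin, metis has_derivative_cos)

section \<open>The coefficients \<open>X\<close> and \<open>Y\<close> and the candidate
  \<open>Q\<^sub>0\<close>\<close>

definition X where
  "X p = dx (dx \<Phi>) p + \<Phi> p - (dx \<Phi> p * cos (\<phi> p) / sin (\<phi> p) + dy \<Phi> p / sin (\<phi> p)) * dx \<phi> p"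

definition Y where
  "Y p = dy (dy \<Phi>) p + \<Phi> p - (dy \<Phi> p * cos (\<phi> p) / sin (\<phi> p) + dx \<Phi> p / sin (\<phi> p)) * dy \<phi> p"

definition Q\<^sub>0 where
  "Q\<^sub>0 p = - (dx \<Phi> p * cos (\<phi> p) / sin (\<phi> p) + dy \<Phi> p / sin (\<phi> p))"

lemma X_eq: "X p = dx (dx \<Phi>) p + \<Phi> p + dx \<phi> p * Q\<^sub>0 p"
  by (simp add: X_def Q\<^sub>0_def algebra_simps)

lemma Q\<^sub>0_differentiable:
  assumes "p \<in> U"
  shows "Q\<^sub>0 differentiable (at p)"
  unfolding Q\<^sub>0_def
  using diff[OF assms] diff_sin_cos[OF assms] sin_nonzero[OF assms]
  by (intro differentiable_minus differentiable_add differentiable_divide differentiable_mult)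

text \<open>The Moutard equation replaces the mixed derivative by
  \<open>\<Phi> p * cos (\<phi> p)\<close>, so \<open>dx (dx \<Phi>) p\<close> is the only second
  derivative left; it is absorbed into \<open>X p\<close>.\<close>

lemma dx_Q\<^sub>0:
  assumes p: "p \<in> U"
  shows "dx Q\<^sub>0 p = dx \<Phi> p * dx \<phi> p - cos (\<phi> p) / sin (\<phi> p) * X p"
proof -
  let ?s = "sin (\<phi> p)" and ?c = "cos (\<phi> p)"
  have c2: "?c * ?c = 1 - ?s * ?s"
    using sin_cos_squared_add[of "\<phi> p"] by (simp add: power2_eq_square)
  have "((\<lambda>t. Q\<^sub>0 (t, snd p)) has_real_derivative
      - (((dx (dx \<Phi>) p * ?c - dx \<Phi> p * (?s * dx \<phi> p)) * ?s - dx \<Phi> p * ?c * (?c * dx \<phi> p)) / (?s * ?s)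
       + (\<Phi> p * ?c * ?s - dy \<Phi> p * (?c * dx \<phi> p)) / (?s * ?s))) (at (fst p))"
    unfolding Q\<^sub>0_def
    using has_real_dx[OF diff(1)[OF p]] has_real_dx[OF diff(4)[OF p]] has_real_dx[OF diff(5)[OF p]] sin_nonzero[OF p]
    by (auto intro!: derivative_eq_intros simp: Phi_yx[OF p])
  then have deriv: "dx Q\<^sub>0 p = - (((dx (dx \<Phi>) p * ?c - dx \<Phi> p * (?s * dx \<phi> p)) * ?s - dx \<Phi> p * ?c * (?c * dx \<phi> p)) / (?s * ?s)
       + (\<Phi> p * ?c * ?s - dy \<Phi> p * (?c * dx \<phi> p)) / (?s * ?s))"
    by (intro dx_eqI) (simp add: has_real_derivative_iff_has_vector_derivative)
  show ?thesis
    unfolding deriv X_def by (use sin_nonzero[OF p] in \<open>simp add: field_simps\<close>; use c2 in algebra)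
qed

lemma dy_Q\<^sub>0:
  assumes p: "p \<in> U"
  shows "dy Q\<^sub>0 p = \<Phi> p * sin (\<phi> p) - Y p / sin (\<phi> p)"
proof -
  let ?s = "sin (\<phi> p)" and ?c = "cos (\<phi> p)"
  have c2: "?c * ?c = 1 - ?s * ?s"
    using sin_cos_squared_add[of "\<phi> p"] by (simp add: power2_eq_square)
  have "((\<lambda>t. Q\<^sub>0 (fst p, t)) has_real_derivative
      - (((\<Phi> p * ?c * ?c - dx \<Phi> p * (?s * dy \<phi> p)) * ?s - dx \<Phi> p * ?c * (?c * dy \<phi> p)) / (?s * ?s)
       + (dy (dy \<Phi>) p * ?s - dy \<Phi> p * (?c * dy \<phi> p)) / (?s * ?s))) (at (snd p))"
    unfolding Q\<^sub>0_def
    using has_real_dy[OF diff(1)[OF p]] has_real_dy[OF diff(4)[OF p]] has_real_dy[OF diff(5)[OF p]] sin_nonzero[OF p]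
    by (auto intro!: derivative_eq_intros simp: Phi_xy[OF p])
  then have deriv: "dy Q\<^sub>0 p = - (((\<Phi> p * ?c * ?c - dx \<Phi> p * (?s * dy \<phi> p)) * ?s - dx \<Phi> p * ?c * (?c * dy \<phi> p)) / (?s * ?s)
       + (dy (dy \<Phi>) p * ?s - dy \<Phi> p * (?c * dy \<phi> p)) / (?s * ?s))"
    by (intro dy_eqI) (simp add: has_real_derivative_iff_has_vector_derivative)
  show ?thesis
    unfolding deriv Y_def by (use sin_nonzero[OF p] in \<open>simp add: field_simps\<close>; use c2 in algebra)
qed

text \<open>Without a value, a statement about all values would be vacuous. The form defining
  \<open>Q\<close> is closed because, by the Moutard and sine-Gordon equations, both cross
  derivatives equal \<open>\<Phi> p * cos (\<phi> p) * dx \<phi> p + dx \<Phi> p * sin (\<phi>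
  p)\<close>.\<close>

lemma recursion_op_nonempty:
  assumes "simply_connected U"
  shows "recursion_op U \<phi> \<Phi> \<noteq> {}"
proof -
  let ?P = "\<lambda>p. dx \<Phi> p * dx \<phi> p" and ?R = "\<lambda>p. \<Phi> p * sin (\<phi> p)"
  have PR: "smooth_on U ?P" "smooth_on U ?R"
    using smooth Ck_on_mult[OF open_U] Ck_on_sin_cos[OF open_U] unfolding smooth_on_def by blast+
  then have "Ck_on 1 U ?P" "Ck_on 1 U ?R" by (simp_all only: smooth_on_def)
  moreover have "dy ?P p = dx ?R p" if p: "p \<in> U" for p
    using diff[OF p] diff_sin_cos[OF p] p
    by (simp add: dy_mult dx_mult dx_dy_sin Phi_xy sine_gordon)
  ultimately obtain Q where Q: "Q differentiable_on U" "\<forall>p\<in>U. dx Q p = ?P p \<and> dy Q p = ?R p"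
    using closed_form_primitive[OF open_U assms] by blast
  \<comment> \<open>The primitive is so far only differentiable; its smoothness follows from that of
    its prescribed partials.\<close>
  have "smooth_on U (dx Q)" "smooth_on U (dy Q)"
    using Q(2) PR unfolding smooth_on_def
    by (metis (no_types, lifting) Ck_on_cong[OF open_U, of ?P "dx Q"],
        metis (no_types, lifting) Ck_on_cong[OF open_U, of ?R "dy Q"])
  with Q(1) have "smooth_on U Q"
    using smooth_on_iff by blast
  with Q(2) have "(\<lambda>p. dx (dx \<Phi>) p + dx \<phi> p * Q p) \<in> recursion_op U \<phi> \<Phi>"
    unfolding recursion_op_def by blast
  then show ?thesis by blast
qed

lemma recursion_zero_iff:
  assumes "connected U" and \<Psi>: "\<Psi> \<in> recursion_op U \<phi> \<Phi>"
  shows "(\<lambda>p. \<Psi> p + \<Phi> p) \<in> recursion_op U \<phi> (\<lambda>p. 0) \<longleftrightarrow> (\<forall>p\<in>U. X p = 0 \<and> Y p = 0)"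
proof -
  obtain Q where Q: "smooth_on U Q" "\<And>p. p \<in> U \<Longrightarrow> dx Q p = dx \<Phi> p * dx \<phi> p"
    "\<And>p. p \<in> U \<Longrightarrow> dy Q p = \<Phi> p * sin (\<phi> p)" "\<And>p. p \<in> U \<Longrightarrow> \<Psi> p = dx (dx \<Phi>) p + dx \<phi> p * Q p"
    using \<Psi> unfolding recursion_op_def by blast
  have dQ: "Q differentiable (at p)" if "p \<in> U" for p
    using smooth_on_differentiable[OF Q(1) open_U that] .
  have "(\<exists>c. \<forall>p\<in>U. \<Psi> p + \<Phi> p = dx \<phi> p * c) \<longleftrightarrow> (\<forall>p\<in>U. X p = 0 \<and> Y p = 0)"
  proof
    assume XY: "\<forall>p\<in>U. X p = 0 \<and> Y p = 0"
    \<comment> \<open>With \<open>X\<close> and \<open>Y\<close> zero, \<open>Q\<^sub>0\<close> has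
      the partials prescribed for \<open>Q\<close>.\<close>
    have "\<exists>c. \<forall>p\<in>U. Q p = Q\<^sub>0 p + c"
      by (rule equal_partials_differ_by_const[OF open_U assms(1) dQ Q\<^sub>0_differentiable])
         (use Q XY in \<open>auto simp: dx_Q\<^sub>0 dy_Q\<^sub>0\<close>)
    then obtain c where "\<And>p. p \<in> U \<Longrightarrow> Q p = Q\<^sub>0 p + c" by blast
    then have "\<Psi> p + \<Phi> p = X p + dx \<phi> p * c" if "p \<in> U" for p
      using Q(4) that by (simp add: X_eq algebra_simps)
    with XY have "\<forall>p\<in>U. \<Psi> p + \<Phi> p = dx \<phi> p * c" by simp
    then show "\<exists>c. \<forall>p\<in>U. \<Psi> p + \<Phi> p = dx \<phi> p * c" by blast
  next
    assume "\<exists>c. \<forall>p\<in>U. \<Psi> p + \<Phi> p = dx \<phi> p * c"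
    then obtain c where c: "\<And>p. p \<in> U \<Longrightarrow> \<Psi> p + \<Phi> p = dx \<phi> p * c" by blast
    have eq: "dx (dx \<Phi>) p + \<Phi> p + dx \<phi> p * (Q p - c) = 0" if "p \<in> U" for p
      using c[OF that] Q(4)[OF that] by (simp add: algebra_simps)
    have Q_eq: "Q p = Q\<^sub>0 p + c" if p: "p \<in> U" for p
    proof -
      \<comment> \<open>The third derivative is found by differentiating the Moutard equation in
        \<open>x\<close>. Its term \<open>- \<Phi> p * sin (\<phi> p) * dx \<phi> p\<close> cancels
        the one that \<open>dy Q p\<close> contributes, which leaves an equation linear in
        \<open>Q p - c\<close> with coefficient \<open>sin (\<phi> p)\<close>.\<close>
      have "dy (dx (dx \<Phi>)) p = dx (\<lambda>q. \<Phi> q * cos (\<phi> q)) p"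
        using smooth_dx_dy_commute[OF smooth(4) open_U p] dx_cong[OF open_U p Phi_xy] by simp
      also have "\<dots> = \<Phi> p * (- sin (\<phi> p) * dx \<phi> p) + dx \<Phi> p * cos (\<phi> p)"
        using diff[OF p] diff_sin_cos[OF p] by (simp add: dx_mult dx_dy_cos)
      finally have "((\<lambda>t. dx (dx \<Phi>) (fst p, t) + \<Phi> (fst p, t) + dx \<phi> (fst p, t) * (Q (fst p, t) - c))
          has_real_derivative \<Phi> p * (- sin (\<phi> p) * dx \<phi> p) + dx \<Phi> p * cos (\<phi> p) + dy \<Phi> p
          + (sin (\<phi> p) * (Q p - c) + \<Phi> p * sin (\<phi> p) * dx \<phi> p)) (at (snd p))"
        using has_real_dy[OF diff(6)[OF p]] has_real_dy[OF diff(2)[OF p]] has_real_dy[OF diff(3)[OF p]]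
          has_real_dy[OF dQ[OF p]] Q(3)[OF p] sine_gordon[OF p]
        by (auto intro!: derivative_eq_intros)
      then have "dy (\<lambda>q. dx (dx \<Phi>) q + \<Phi> q + dx \<phi> q * (Q q - c)) p
          = dx \<Phi> p * cos (\<phi> p) + dy \<Phi> p + sin (\<phi> p) * (Q p - c)"
        by (intro dy_eqI) (simp add: has_real_derivative_iff_has_vector_derivative algebra_simps)
      moreover have "dy (\<lambda>q. dx (dx \<Phi>) q + \<Phi> q + dx \<phi> q * (Q q - c)) p = 0"
        using dy_cong[OF open_U p eq] by (simp add: dx_dy_const)
      ultimately show ?thesis
        using sin_nonzero[OF p] by (simp add: Q\<^sub>0_def field_simps)
    qed
    have "X p = 0 \<and> Y p = 0" if p: "p \<in> U" for p
    proof
      show "X p = 0"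
        using eq[OF p] Q_eq[OF p] by (simp add: X_eq algebra_simps)
      \<comment> \<open>Comparison of the prescribed \<open>dy Q p\<close> with
        \<open>dy Q\<^sub>0 p\<close> isolates \<open>Y p / sin (\<phi> p)\<close>.\<close>
      have "dy Q p = dy (\<lambda>q. Q\<^sub>0 q + c) p"
        using dy_cong[OF open_U p Q_eq] .
      also have "\<dots> = dy Q\<^sub>0 p"
        using has_dy[OF Q\<^sub>0_differentiable[OF p]] by (intro dy_eqI) (auto intro!: derivative_eq_intros)
      finally show "Y p = 0"
        using Q(3)[OF p] dy_Q\<^sub>0[OF p] sin_nonzero[OF p] by simp
    qed
    then show "\<forall>p\<in>U. X p = 0 \<and> Y p = 0" by blast
  qed
  then show ?thesis
    using recursion_op_zero_iff[OF open_U assms(1)] by simp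
qed

end

subsection \<open>Degenerate Voss nets\<close>

lemma (in dini_surface) voss_derivatives:
  assumes moutard: "moutard U \<phi> \<Phi>" and p: "p \<in> U"
  shows "((\<lambda>t. voss \<phi> r n \<Phi> (t, snd p)) has_vector_derivative
           (- moutard.X \<phi> \<Phi> p / sin (\<phi> p)) *\<^sub>R dy r p) (at (fst p))"
    and "((\<lambda>t. voss \<phi> r n \<Phi> (fst p, t)) has_vector_derivative
           (- moutard.Y \<phi> \<Phi> p / sin (\<phi> p)) *\<^sub>R dx r p) (at (snd p))"
proof -
  obtain x y where xy: "p = (x, y)" by (cases p)
  note D = diff[OF p] moutard.diff[OF moutard p]
  \<comment> \<open>The facts \<open>D(3-5)\<close> concern \<open>n\<close>, \<open>dx r\<close>,
    \<open>dy r\<close>, and \<open>D(7,8,10,11)\<close> concern \<open>\<phi>\<close>,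
    \<open>\<Phi>\<close>, \<open>dx \<Phi>\<close>, \<open>dy \<Phi>\<close>; both families are
    restricted to the coordinate lines through \<open>p\<close>.\<close>
  note Dx = D(3-5)[THEN has_dx, unfolded xy fst_conv snd_conv]
    and Dy = D(3-5)[THEN has_dy, unfolded xy fst_conv snd_conv]
    and Rx = D(7,8,10,11)[THEN has_real_dx, unfolded xy fst_conv snd_conv]
    and Ry = D(7,8,10,11)[THEN has_real_dy, unfolded xy fst_conv snd_conv]
  interpret moutard U \<phi> \<Phi> by fact
  have sin0: "sin (\<phi> (x, y)) \<noteq> 0" using sin_nonzero[OF p] xy by simp
  note inner = frame[OF p] frame(3)[OF p, unfolded inner_commute[of "dx r p"]]
    second_form[OF p] inner_rxx[OF p] inner_rxy[OF p] inner_ryy[OF p] inner_nx[OF p] inner_ny[OF p]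
  show "((\<lambda>t. voss \<phi> r n \<Phi> (t, snd p)) has_vector_derivative
           (- X p / sin (\<phi> p)) *\<^sub>R dy r p) (at (fst p))"
    using voss_curve_derivative[where u = "\<lambda>t. dx \<Phi> (t, y)" and v = "\<lambda>t. dy \<Phi> (t, y)",
        OF Dx(2,3,1) Rx(1-3) _ sin0] Rx(4)
    by (simp add: voss_def X_def inner[unfolded xy] dx_dy_r[OF p, unfolded xy] Phi_yx[OF p, unfolded xy] xy)
  show "((\<lambda>t. voss \<phi> r n \<Phi> (fst p, t)) has_vector_derivative
           (- Y p / sin (\<phi> p)) *\<^sub>R dx r p) (at (snd p))"
    using voss_curve_derivative[where u = "\<lambda>t. dy \<Phi> (x, t)" and v = "\<lambda>t. dx \<Phi> (x, t)",
        OF Dy(3,2,1) Ry(1,2,4) _ sin0] Ry(3)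
    by (simp add: voss_def Y_def inner[unfolded xy] Phi_xy[OF p, unfolded xy] xy add.commute)
qed

text \<open>The partial derivatives of the net are multiples of the unit vectors \<open>dy r\<close>
  and \<open>dx r\<close>, so they vanish only with their coefficients; on a connected domain
  vanishing partials mean a constant net.\<close>

lemma (in dini_surface) degenerate_voss_iff:
  assumes moutard: "moutard U \<phi> \<Phi>" and "connected U"
  shows "degenerate_net U (voss \<phi> r n \<Phi>) \<longleftrightarrow>
    (\<forall>p\<in>U. moutard.X \<phi> \<Phi> p = 0 \<and> moutard.Y \<phi> \<Phi> p = 0)"
proof
  let ?q = "voss \<phi> r n \<Phi>"
  assume "degenerate_net U ?q"
  then obtain c where c: "\<And>p. p \<in> U \<Longrightarrow> ?q p = c"
    unfolding degenerate_net_def constant_on_def by blast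
  show "\<forall>p\<in>U. moutard.X \<phi> \<Phi> p = 0 \<and> moutard.Y \<phi> \<Phi> p = 0"
  proof
    fix p assume p: "p \<in> U"
    have "dx ?q p = 0" "dy ?q p = 0"
      using dx_cong[OF open_U p c] dy_cong[OF open_U p c] by (simp_all add: dx_dy_const)
    moreover have "dx r p \<noteq> 0" "dy r p \<noteq> 0"
      using frame(1,2)[OF p] by auto
    ultimately show "moutard.X \<phi> \<Phi> p = 0 \<and> moutard.Y \<phi> \<Phi> p = 0"
      using dx_eqI[OF voss_derivatives(1)[OF moutard p]] dy_eqI[OF voss_derivatives(2)[OF moutard p]]
        sin_nonzero[OF p] by simp
  qed
next
  let ?q = "voss \<phi> r n \<Phi>"
  assume XY: "\<forall>p\<in>U. moutard.X \<phi> \<Phi> p = 0 \<and> moutard.Y \<phi> \<Phi> p = 0"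
  have "?q differentiable (at p)" if p: "p \<in> U" for p
    unfolding voss_def
    using diff[OF p] moutard.diff[OF moutard p] moutard.diff_sin_cos[OF moutard p] sin_nonzero[OF p]
    by (intro differentiable_diff differentiable_add differentiable_divide differentiable_scaleR differentiable_const)
  moreover have "dx ?q p = 0" "dy ?q p = 0" if p: "p \<in> U" for p
    using dx_eqI[OF voss_derivatives(1)[OF moutard p]] dy_eqI[OF voss_derivatives(2)[OF moutard p]] XY p
    by simp_all
  ultimately have "\<exists>c. \<forall>p\<in>U. ?q p = 0 + c"
    using equal_partials_differ_by_const[OF open_U \<open>connected U\<close>, of ?q "\<lambda>p. 0"] by (simp add: dx_dy_const)
  then show "degenerate_net U ?q"
    unfolding degenerate_net_def constant_on_def by simp
qed

theorem lemma6p1: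
  fixes U :: "(real \<times> real) set"
    and \<phi> \<Phi> :: "real \<times> real \<Rightarrow> real"
    and r n :: "real \<times> real \<Rightarrow> real^3"
  assumes "open U" and "connected U" and "simply_connected U"
    and "pseudospherical_dini U \<phi> r n"
    and "moutard_solution U \<phi> \<Phi>"
  shows "recursion_op U \<phi> \<Phi> \<noteq> {} \<and>
         (\<forall>\<Psi>\<in>recursion_op U \<phi> \<Phi>.
            degenerate_net U (voss \<phi> r n \<Phi>) \<longleftrightarrow>
            (\<lambda>p. \<Psi> p + \<Phi> p) \<in> recursion_op U \<phi> (\<lambda>p. 0))"
proof -
  interpret dini_surface U \<phi> r n
    using assms by unfold_locales
  \<comment> \<open>The surface supplies the sine-Gordon equation, which links the geometry to the
    recursion operator.\<close>
  have m: "moutard U \<phi> \<Phi>"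
    using smooth(1) open_U sin_nonzero sine_gordon assms(5) by unfold_locales
  show ?thesis
    using moutard.recursion_op_nonempty[OF m assms(3)] degenerate_voss_iff[OF m assms(2)]
      moutard.recursion_zero_iff[OF m assms(2)] by blast
qed

end
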